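(* Let $C$ be a comb domain. Then ${\rm h}(C)\geq 1$. Conversely, for every $p\in[1,+\infty]$ there exists a comb domain $C$ with ${\rm h}(C)=p$.
   Context: For $p>0$, the Hardy space $H^p(\mathbb{D})$ is the set of holomorphic functions $f$ on the unit disk $\mathbb{D}$ with $\sup_{0<r<1}\int_0^{2\pi}|f(re^{i\theta})|^p\,d\theta<+\infty$. For a simply connected domain $D\neq\mathbb{C}$ with a Riemann map $f:\mathbb{D}\to D$ (a conformal map of $\mathbb{D}$ onto $D$), the Hardy number of $D$ is ${\rm h}(D)=\sup\{p>0: f\in H^p(\mathbb{D})\}$ (this is independent of the choice of Riemann map and may equal $+\infty$). A comb domain is defined as follows: let $\{x_n\}_{n\in\mathbb{Z}}$ be a strictly increasing sequence of real numbers with $x_0=0$ and $\inf_{n\in\mathbb{Z}}(x_n-x_{n-1})>0$, and let $\{b_n\}_{n\in\mathbb{Z}}$ be a sequence of positive numbers; the domain $C=\mathbb{C}\setminus\bigcup_{n\in\mathbb{Z}}\{x_n+iy: |y|\ge b_n\}$ is called a comb domain. *)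

theory Defs
  imports "HOL-Complex_Analysis.Complex_Analysis"
begin

definition in_hardy :: "real \<Rightarrow> (complex \<Rightarrow> complex) \<Rightarrow> bool" where
  "in_hardy p f \<longleftrightarrow> f holomorphic_on ball 0 1 \<and>
     (\<exists>M. \<forall>r\<in>{0<..<1}.
        integral {0..2*pi} (\<lambda>\<theta>. norm (f (complex_of_real r * cis \<theta>)) powr p) \<le> M)"

definition riemann_map :: "(complex \<Rightarrow> complex) \<Rightarrow> complex set \<Rightarrow> bool" where
  "riemann_map f D \<longleftrightarrow> f holomorphic_on ball 0 1 \<and> inj_on f (ball 0 1) \<and> f ` ball 0 1 = D"

definition hardy_number :: "complex set \<Rightarrow> ereal" where
  "hardy_number D = Sup {ereal p | p. p > 0 \<and> in_hardy p (SOME f. riemann_map f D)}"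

definition comb_domain :: "(int \<Rightarrow> real) \<Rightarrow> (int \<Rightarrow> real) \<Rightarrow> complex set" where
  "comb_domain x b = - (\<Union>n. {Complex (x n) y | y. \<bar>y\<bar> \<ge> b n})"

definition is_comb_domain :: "complex set \<Rightarrow> bool" where
  "is_comb_domain C \<longleftrightarrow> (\<exists>x b.
     strict_mono x \<and> x 0 = 0 \<and> (\<exists>\<delta>>0. \<forall>n. x n - x (n - 1) \<ge> \<delta>) \<and>
     (\<forall>n. b n > 0) \<and> C = comb_domain x b)"

end

theory Submission
  imports Defs "HOL-Real_Asymp.Real_Asymp"
begin

text \<open>
  A function omitting the two rays of the slit \<open>x\<^sub>0 = 0\<close> belongs to \<open>H\<^sup>p\<close> for all \<open>p < 1\<close>, because a branch of
  \<open>(1 + (f / b\<^sub>0)\<^sup>2)\<^sup>p\<^sup>/\<^sup>2\<close> takes values in a sector around the positive axis; hence the Hardy number is at least \<open>1\<close>.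

  For the converse, combs with symmetric slits are parametrised explicitly: for coefficients \<open>c\<^sub>k\<close> bounded below with
  \<open>\<Sum>c\<^sub>k / 2\<^sup>k < \<infinity>\<close> put \<open>A s = \<Sum>c\<^sub>k arctan (s / 2\<^sup>k\<^sup>+\<^sup>1)\<close>. Then \<open>F s = A s - A (1 / s)\<close> maps the right half-plane
  conformally onto a comb domain: in the coordinate \<open>\<zeta> = ln s\<close> its derivative has positive real part on a convex strip,
  and on the imaginary axis \<open>Re F\<close> is a step function with jumps at \<open>|s| = 2\<^sup>k\<^sup>+\<^sup>1\<close> and \<open>|s| = 2\<^sup>-\<^sup>k\<^sup>-\<^sup>1\<close>. The Hardy number is
  governed by the growth of \<open>c\<close>: with \<open>c\<^sub>k = 2\<^sup>a\<^sup>k\<close> it is \<open>1 / a\<close>, and \<open>c\<^sub>k = 2\<^sup>k / (k + 1)\<^sup>2\<close> gives \<open>1\<close>. The upper bound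
  comes from the growth \<open>|f z|\<^sup>p = O (1 / (1 - |z|))\<close> in \<open>H\<^sup>p\<close>. The lower bound comes from an explicit harmonic majorant of
  \<open>|F|\<^sup>q\<close>: the sums \<open>A\<close> have positive real part, and \<open>(Re A)\<^sup>q\<close> is dominated by \<open>Re B\<close> for a sum \<open>B\<close> of the same kind
  with coefficients slightly larger than \<open>c\<^sub>k\<^sup>q\<close>.
\<close>

section \<open>Hardy spaces on the disc\<close>

lemma powr_add_le:
  fixes x y q :: real
  assumes "x \<ge> 0" "y \<ge> 0" "q \<ge> 0"
  shows "(x + y) powr q \<le> 2 powr q * (x powr q + y powr q)"
proof -
  have "(x + y) powr q \<le> (2 * max x y) powr q"
    using assms by (intro powr_mono2) auto
  also have "\<dots> = 2 powr q * max x y powr q"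
    using assms by (simp add: powr_mult)
  also have "max x y powr q \<le> x powr q + y powr q"
    by (auto simp: max_def)
  finally show ?thesis
    by simp
qed

text \<open>Cauchy's formula parametrised by \<open>cis\<close>, so that it speaks about the same
  integrals over \<open>{0..2*pi}\<close> as \<open>in_hardy\<close>.\<close>

lemma cauchy_formula_cis:
  fixes h :: "complex \<Rightarrow> complex" and r :: real
  assumes "h holomorphic_on ball 0 1" "0 < r" "r < 1" "norm w < r"
  shows "((\<lambda>t. h (r * cis t) / (r * cis t - w) * r * cis t) has_integral (2 * pi * h w)) {0..2*pi}"
proof -
  have "h holomorphic_on cball 0 r"
    using assms by (intro holomorphic_on_subset[OF assms(1)]) auto
  then have "((\<lambda>u. h u / (u - w)) has_contour_integral (2 * of_real pi * \<i> * h w)) (part_circlepath 0 r 0 (2*pi))"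
    using Cauchy_integral_circlepath_simple[of h 0 r w] assms by (simp add: circlepath_def)
  then have "((\<lambda>t. h (0 + r * cis t) / (0 + r * cis t - w) * r * \<i> * cis t) has_integral
               (2 * of_real pi * \<i> * h w)) {0..2*pi}"
    by (subst (asm) has_contour_integral_part_circlepath_iff) auto
  from has_integral_mult_right[OF this, of "-\<i>"] show ?thesis
    by (simp add: algebra_simps)
qed

lemma mean_value_cis:
  fixes h :: "complex \<Rightarrow> complex" and r :: real
  assumes "h holomorphic_on ball 0 1" "0 < r" "r < 1"
  shows "((\<lambda>t. h (r * cis t)) has_integral (2 * pi * h 0)) {0..2*pi}"
  using cauchy_formula_cis[OF assms(1), of r 0] assms by simp

lemma of_real_mult_cis_in_ball:
  assumes "0 < r" "r < 1"
  shows "of_real r * cis t \<in> ball 0 1"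
  using assms by (simp add: norm_mult)

lemma norm_powr_integrable_circle:
  fixes f :: "complex \<Rightarrow> complex" and r :: real
  assumes "f holomorphic_on ball 0 1" "0 < r" "r < 1" "0 < p"
  shows "(\<lambda>\<theta>. norm (f (complex_of_real r * cis \<theta>)) powr p) integrable_on {0..2*pi}"
proof (rule integrable_continuous_real)
  have "continuous_on (ball 0 1) f"
    using assms holomorphic_on_imp_continuous_on by blast
  then have "continuous_on {0..2*pi} (\<lambda>\<theta>. f (complex_of_real r * cis \<theta>))"
    by (rule continuous_on_compose2) (use assms of_real_mult_cis_in_ball in \<open>auto intro!: continuous_intros\<close>)
  then show "continuous_on {0..2*pi} (\<lambda>\<theta>. norm (f (complex_of_real r * cis \<theta>)) powr p)"
    using assms by (intro continuous_on_powr' continuous_intros) auto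
qed

text \<open>The mean of \<open>Re H\<close> over a circle about 0 is \<open>Re (H 0)\<close>
  whatever the radius, so one constant bounds all integral means of \<open>f\<close>. Every proof of
  membership below goes through this criterion.\<close>

lemma in_hardy_harmonic_majorant:
  fixes f H :: "complex \<Rightarrow> complex"
  assumes "0 < p" "f holomorphic_on ball 0 1" "H holomorphic_on ball 0 1"
    and "\<And>z. z \<in> ball 0 1 \<Longrightarrow> norm (f z) powr p \<le> Re (H z)"
  shows "in_hardy p f"
  unfolding in_hardy_def
proof (intro conjI exI ballI)
  fix r :: real
  assume r: "r \<in> {0<..<1}"
  have Re_int: "((\<lambda>t. Re (H (r * cis t))) has_integral Re (2 * pi * H 0)) {0..2*pi}"
    by (rule has_integral_Re[OF mean_value_cis[OF assms(3)]]) (use r in auto)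
  have norm_int: "((\<lambda>\<theta>. norm (f (complex_of_real r * cis \<theta>)) powr p) has_integral
      integral {0..2*pi} (\<lambda>\<theta>. norm (f (complex_of_real r * cis \<theta>)) powr p)) {0..2*pi}"
    using norm_powr_integrable_circle[OF assms(2)] r assms(1) by (intro integrable_integral) auto
  show "integral {0..2*pi} (\<lambda>\<theta>. norm (f (complex_of_real r * cis \<theta>)) powr p) \<le> Re (2 * pi * H 0)"
    by (rule has_integral_le[OF norm_int Re_int], rule assms(4), rule of_real_mult_cis_in_ball) (use r in auto)
qed (use assms in auto)

text \<open>As \<open>f\<close> omits a vertical ray issuing from \<open>\<i> b\<close>, the power \<open>(\<i> (f - \<i> b))\<^sup>p\<close> is holomorphic, which
  makes Cauchy's formula available for every \<open>p > 0\<close>.\<close>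

lemma in_hardy_growth:
  fixes f :: "complex \<Rightarrow> complex" and b :: real
  assumes hardy: "in_hardy p f" and p: "0 < p"
    and omit: "\<And>z t. z \<in> ball 0 1 \<Longrightarrow> t \<ge> b \<Longrightarrow> f z \<noteq> Complex 0 t"
  shows "\<exists>K. \<forall>z\<in>ball 0 1. norm (f z) powr p \<le> K / (1 - norm z)"
proof -
  define h where "h = (\<lambda>z. (\<i> * (f z - \<i> * b)) powr of_real p)"
  have holf: "f holomorphic_on ball 0 1"
    using hardy by (simp add: in_hardy_def)
  obtain M where M: "\<forall>r\<in>{0<..<1::real}.
      integral {0..2*pi} (\<lambda>\<theta>. norm (f (complex_of_real r * cis \<theta>)) powr p) \<le> M"
    using hardy unfolding in_hardy_def by blast
  have notneg: "\<i> * (f z - \<i> * b) \<notin> \<real>\<^sub>\<le>\<^sub>0" if "z \<in> ball 0 1" for z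
  proof
    assume *: "\<i> * (f z - \<i> * b) \<in> \<real>\<^sub>\<le>\<^sub>0"
    then have "f z = Complex 0 (Im (f z))" "Im (f z) \<ge> b"
      by (auto simp: complex_nonpos_Reals_iff complex_eq_iff)
    then show False
      using omit that by metis
  qed
  have holh: "h holomorphic_on ball 0 1"
    unfolding h_def using notneg by (intro holomorphic_intros holf) auto
  have normh: "norm (h z) = norm (f z - \<i> * b) powr p" for z
    by (simp add: h_def norm_powr_real_powr' norm_mult)
  define B where "B = \<bar>b\<bar> powr p"
  have hle: "norm (h z) \<le> 2 powr p * (norm (f z) powr p + B)" for z
  proof -
    have "norm (h z) \<le> (norm (f z) + \<bar>b\<bar>) powr p"
      unfolding normh using p norm_triangle_ineq4[of "f z" "\<i> * b"]
      by (intro powr_mono2) (auto simp: norm_mult)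
    also have "\<dots> \<le> 2 powr p * (norm (f z) powr p + B)"
      unfolding B_def using p by (intro powr_add_le) auto
    finally show ?thesis .
  qed
  have fle: "norm (f z) powr p \<le> 2 powr p * (norm (h z) + B)" for z
  proof -
    have "norm (f z) \<le> norm (f z - \<i> * b) + \<bar>b\<bar>"
      using norm_triangle_sub[of "f z" "\<i> * b"] by (auto simp: norm_mult)
    then have "norm (f z) powr p \<le> (norm (f z - \<i> * b) + \<bar>b\<bar>) powr p"
      using p by (intro powr_mono2) auto
    also have "\<dots> \<le> 2 powr p * (norm (h z) + B)"
      unfolding B_def normh using p by (intro powr_add_le) auto
    finally show ?thesis .
  qed
  \<comment> \<open>The bound for the means of \<open>f\<close>, carried over to \<open>h\<close> by
    integrating \<open>hle\<close> over an interval of length \<open>2 * pi\<close>.\<close>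
  define M' where "M' = 2 powr p * (M + 2 * pi * B)"
  have hint: "integral {0..2*pi} (\<lambda>\<theta>. norm (h (r * cis \<theta>))) \<le> M'" if r: "0 < r" "r < 1" for r :: real
  proof -
    let ?F = "\<lambda>\<theta>. norm (f (complex_of_real r * cis \<theta>)) powr p"
    have i1: "?F integrable_on {0..2*pi}"
      using norm_powr_integrable_circle[OF holf] r p by auto
    then have i2: "(\<lambda>\<theta>. ?F \<theta> + B) integrable_on {0..2*pi}"
      by (intro integrable_add) auto
    have "integral {0..2*pi} (\<lambda>\<theta>. norm (h (r * cis \<theta>))) \<le> integral {0..2*pi} (\<lambda>\<theta>. 2 powr p * (?F \<theta> + B))"
      using norm_powr_integrable_circle[OF holh, of r 1] r hle i2
      by (intro integral_le integrable_on_cmult_left) auto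
    also have "\<dots> = 2 powr p * (integral {0..2*pi} ?F + 2 * pi * B)"
      using i1 by (simp add: integral_add[OF i1 integrable_const_ivl])
    also have "\<dots> \<le> M'"
      unfolding M'_def using M r by (intro mult_left_mono) auto
    finally show ?thesis .
  qed
  have M'0: "0 \<le> M'"
    using order_trans[OF integral_nonneg hint[of "1/2"]] norm_powr_integrable_circle[OF holh, of "1/2" 1] by auto
  have hgrowth: "norm (h w) \<le> M' / (1 - norm w)" if w: "w \<in> ball 0 1" for w
  proof -
    \<comment> \<open>The midpoint of \<open>norm w\<close> and 1: then \<open>r - norm w\<close> is
      half of \<open>1 - norm w\<close>, so the Cauchy kernel costs only a factor
      \<open>2 / (1 - norm w)\<close>.\<close>
    define r where "r = (1 + norm w) / 2"
    have r: "0 < r" "r < 1" "norm w < r"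
      using w by (auto simp: r_def)
         (smt (verit) norm_ge_zero)
    note ci = cauchy_formula_cis[OF holh r]
    have "norm (2 * pi * h w) \<le> integral {0..2*pi} (\<lambda>\<theta>. norm (h (r * cis \<theta>)) * (r / (r - norm w)))"
    proof -
      have "norm (integral {0..2*pi} (\<lambda>t. h (r * cis t) / (r * cis t - w) * r * cis t)) \<le>
          integral {0..2*pi} (\<lambda>\<theta>. norm (h (r * cis \<theta>)) * (r / (r - norm w)))"
      proof (rule integral_norm_bound_integral)
        fix t
        have "r - norm w \<le> norm (r * cis t - w)"
          using norm_triangle_ineq2[of "r * cis t" w] r by (simp add: norm_mult)
        then have "norm (h (r * cis t)) * r / norm (r * cis t - w) \<le> norm (h (r * cis t)) * r / (r - norm w)"
          using r by (intro divide_left_mono) (auto intro!: mult_pos_pos)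
        then show "norm (h (r * cis t) / (r * cis t - w) * r * cis t) \<le> norm (h (r * cis t)) * (r / (r - norm w))"
          using r by (simp add: norm_mult norm_divide)
      qed (use ci norm_powr_integrable_circle[OF holh, of r 1] r in \<open>auto simp: has_integral_iff intro!: integrable_on_cmult_right integrable_on_divide\<close>)
      then show ?thesis
        using ci by (simp add: has_integral_iff)
    qed
    also have "\<dots> = integral {0..2*pi} (\<lambda>\<theta>. norm (h (r * cis \<theta>))) * (r / (r - norm w))"
      by simp
    also have "\<dots> \<le> M' * (r / (r - norm w))"
      using hint[of r] r by (intro mult_right_mono) auto
    also have "\<dots> \<le> M' * (1 / (r - norm w))"
      using r M'0 by (intro mult_left_mono divide_right_mono) auto
    also have "\<dots> = 2 * (M' / (1 - norm w))"
      using w by (simp add: r_def field_simps)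
    finally have "2 * pi * norm (h w) \<le> 2 * (M' / (1 - norm w))"
      by (simp add: norm_mult)
    moreover have "1 * norm (h w) \<le> pi * norm (h w)"
      using pi_ge_two by (intro mult_right_mono) auto
    ultimately show ?thesis
      by simp
  qed
  show ?thesis
  proof (intro exI ballI)
    fix z :: complex
    assume z: "z \<in> ball 0 1"
    have B0: "0 \<le> B"
      by (simp add: B_def)
    have "B \<le> B / (1 - norm z)"
      using z B0 by (simp add: field_simps)
    then have "2 powr p * (norm (h z) + B) \<le> 2 powr p * (M' / (1 - norm z) + B / (1 - norm z))"
      using hgrowth[OF z] by (intro mult_left_mono add_mono) auto
    then show "norm (f z) powr p \<le> 2 powr p * (M' + B) / (1 - norm z)"
      using fle[of z] by (simp add: add_divide_distrib distrib_left)
  qed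
qed

section \<open>Comparison of two Riemann maps near the unit circle\<close>

text \<open>Schwarz's lemma, applied after a Moebius map that moves \<open>\<psi> 0\<close> to 0.
  With \<open>\<psi>\<close> the transition between two Riemann maps of one domain, growth bounds in
  terms of \<open>1 / (1 - norm z)\<close> survive the change of map up to a constant.\<close>

lemma disc_self_map_boundary_distance:
  fixes \<psi> :: "complex \<Rightarrow> complex"
  assumes hol: "\<psi> holomorphic_on ball 0 1" and into: "\<psi> ` ball 0 1 \<subseteq> ball 0 1"
  shows "\<exists>c>0. \<forall>z\<in>ball 0 1. c * (1 - norm z) \<le> 1 - norm (\<psi> z)"
proof -
  define a where "a = \<psi> 0"
  have a: "norm a < 1"
    using into by (force simp: a_def)
  define \<phi> where "\<phi> = (\<lambda>z. Moebius_function 0 a (\<psi> z))"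
  \<comment> \<open>The reciprocal of \<open>(1 - (norm a)\<^sup>2) / (1 - norm a)\<^sup>2\<close>,
    the constant that the Moebius identity \<open>id\<close> produces.\<close>
  define k where "k = (1 - norm a) / (1 + norm a)"
  have "0 < k"
    using a by (auto simp: k_def intro!: divide_pos_pos add_pos_nonneg)
  have le: "k * (1 - (norm z)\<^sup>2) \<le> 1 - (norm (\<psi> z))\<^sup>2" if z: "z \<in> ball 0 1" for z
  proof -
    have "\<phi> holomorphic_on ball 0 1"
      unfolding \<phi>_def using into
      by (intro holomorphic_on_compose_gen[OF hol Moebius_function_holomorphic[OF a], unfolded o_def]) auto
    moreover have "\<phi> 0 = 0"
      by (simp add: \<phi>_def a_def Moebius_function_eq_zero)
    moreover have "norm (\<phi> u) < 1" if "norm u < 1" for u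
      unfolding \<phi>_def using into that a by (intro Moebius_function_norm_lt_1) (auto simp: image_subset_iff)
    ultimately have "norm (\<phi> z) \<le> norm z"
      using Schwarz_Lemma(1)[of \<phi> z] z by auto
    then have 1: "1 - (norm z)\<^sup>2 \<le> 1 - (norm (\<phi> z))\<^sup>2"
      by (simp add: power_mono)
    define v where "v = \<psi> z"
    have v: "norm v < 1"
      using into z by (auto simp: v_def image_subset_iff)
    have "1 - norm a \<le> norm (1 - cnj a * v)"
    proof -
      have "norm (cnj a * v) \<le> norm a"
        using v by (simp add: norm_mult mult_left_le)
      then show ?thesis
        using norm_triangle_ineq2[of 1 "cnj a * v"] by simp
    qed
    then have 2: "(1 - norm a)\<^sup>2 \<le> (norm (1 - cnj a * v))\<^sup>2"
      using a by (intro power_mono) auto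
    have id: "(norm (1 - cnj a * v))\<^sup>2 - (norm (v - a))\<^sup>2 = (1 - (norm a)\<^sup>2) * (1 - (norm v)\<^sup>2)"
      by (simp add: cmod_power2) (simp add: power2_eq_square algebra_simps)
    have pos: "0 < (norm (1 - cnj a * v))\<^sup>2"
      using 2 a by (smt (verit) zero_less_power)
    have "1 - (norm (\<phi> z))\<^sup>2 = (1 - (norm a)\<^sup>2) * (1 - (norm v)\<^sup>2) / (norm (1 - cnj a * v))\<^sup>2"
      unfolding \<phi>_def Moebius_function_simple v_def[symmetric] id[symmetric]
      using pos by (simp add: norm_divide power_divide field_simps)
    also have "\<dots> \<le> (1 - (norm a)\<^sup>2) * (1 - (norm v)\<^sup>2) / (1 - norm a)\<^sup>2"
      using 2 a v pos by (intro divide_left_mono mult_nonneg_nonneg mult_pos_pos) (auto simp: power_le_one)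
    also have "\<dots> = (1 - (norm v)\<^sup>2) / k"
      using a \<open>0 < k\<close> by (simp add: k_def power2_eq_square divide_simps) (simp add: algebra_simps)
    finally have "k * (1 - (norm (\<phi> z))\<^sup>2) \<le> 1 - (norm v)\<^sup>2"
      using \<open>0 < k\<close> by (simp add: field_simps)
    then show ?thesis
      using mult_left_mono[OF 1, of k] \<open>0 < k\<close> unfolding v_def by linarith
  qed
  show ?thesis
  proof (intro exI conjI ballI)
    fix z :: complex
    assume z: "z \<in> ball 0 1"
    have "norm (\<psi> z) < 1"
      using into z by (auto simp: image_subset_iff)
    \<comment> \<open>From squares to first powers: for \<open>x\<close> in \<open>{0..1}\<close>
      the value \<open>1 - x\<^sup>2\<close> lies between \<open>1 - x\<close> and
      \<open>2 * (1 - x)\<close>, which halves the constant.\<close>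
    then have *: "1 - (norm (\<psi> z))\<^sup>2 \<le> 2 * (1 - norm (\<psi> z))"
      using zero_le_power2[of "1 - norm (\<psi> z)"] by (simp add: power2_eq_square algebra_simps)
    have "(norm z)\<^sup>2 \<le> norm z"
      using z by (simp add: power2_eq_square mult_left_le)
    then have "k * (1 - norm z) \<le> k * (1 - (norm z)\<^sup>2)"
      using \<open>0 < k\<close> by simp
    then show "k / 2 * (1 - norm z) \<le> 1 - norm (\<psi> z)"
      using le[OF z] * by simp
  qed (use \<open>0 < k\<close> in auto)
qed

section \<open>Comb domains and the lower bound\<close>

lemma Re_powr_of_real:
  fixes v :: complex
  assumes "v \<noteq> 0"
  shows "Re (v powr of_real a) = norm v powr a * cos (a * Arg v)"
  using assms by (simp add: powr_def Re_exp Arg_eq_Im_Ln)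

lemma mem_comb_domain: "z \<in> comb_domain x b \<longleftrightarrow> (\<forall>n. Re z = x n \<longrightarrow> \<bar>Im z\<bar> < b n)"
  unfolding comb_domain_def
  by (auto simp: not_le) (metis complex_surj not_le)

lemma gap_le_dist:
  fixes x :: "int \<Rightarrow> real"
  assumes "strict_mono x" "\<And>n. x n - x (n - 1) \<ge> \<delta>" "m \<noteq> n"
  shows "\<bar>x n - x m\<bar> \<ge> \<delta>"
proof -
  have *: "x n - x m \<ge> \<delta>" if "m < n" for m n
    using assms(2)[of n] strict_mono_mono[OF assms(1), THEN monoD, of m "n - 1"] that by linarith
  show ?thesis
    using *[of m n] *[of n m] assms(3) by linarith
qed

text \<open>The gap makes the slits locally finite: a ball of radius \<open>\<delta> / 2\<close>
  meets at most one of the vertical lines, and a single slit is closed.\<close>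

lemma open_comb_domain:
  assumes "strict_mono x" "\<delta> > 0" "\<And>n. x n - x (n - 1) \<ge> \<delta>"
  shows "open (comb_domain x b)"
proof (subst open_subopen, intro ballI)
  fix z
  assume z: "z \<in> comb_domain x b"
  \<comment> \<open>If no abscissa is that close to \<open>Re z\<close>, the property is vacuous and
    any \<open>n\<close> serves.\<close>
  obtain n where n: "\<And>m. \<bar>Re z - x m\<bar> < \<delta> / 2 \<Longrightarrow> m = n"
  proof (cases "\<exists>n. \<bar>Re z - x n\<bar> < \<delta> / 2")
    case True
    then obtain n where "\<bar>Re z - x n\<bar> < \<delta> / 2"
      by blast
    then show ?thesis
      using that[of n] gap_le_dist[OF assms(1,3)] by (smt (verit) field_sum_of_halves)
  qed (use that in blast)
  let ?T = "ball z (\<delta> / 2) \<inter> - {w. Re w = x n \<and> b n \<le> \<bar>Im w\<bar>}"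
  show "\<exists>T. open T \<and> z \<in> T \<and> T \<subseteq> comb_domain x b"
  proof (intro exI[of _ ?T] conjI subsetI)
    show "open ?T"
      by (intro open_Int open_Compl closed_Collect_conj closed_Collect_eq closed_Collect_le continuous_intros) auto
    show "z \<in> ?T"
      using z assms(2) by (auto simp: mem_comb_domain)
    fix w
    assume w: "w \<in> ?T"
    have "\<bar>Re z - Re w\<bar> < \<delta> / 2"
      using w abs_Re_le_cmod[of "z - w"] by (simp add: dist_norm)
    then show "w \<in> comb_domain x b"
      using w n by (auto simp: mem_comb_domain not_le)
  qed
qed

text \<open>The domain is contracted in two linear homotopies: vertically onto the real axis, which
  decreases \<open>\<bar>Im z\<bar>\<close> and so avoids the slits, then along the real axis to
  0.\<close>

lemma simply_connected_comb_domain: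
  assumes "\<And>n. b n > 0"
  shows "simply_connected (comb_domain x b)"
proof -
  let ?C = "comb_domain x b"
  have "homotopic_with_canon (\<lambda>_. True) ?C ?C id (\<lambda>z. of_real (Re z))"
  proof (rule homotopic_with_linear)
    fix z
    assume z: "z \<in> ?C"
    show "closed_segment (id z) (of_real (Re z)) \<subseteq> ?C"
    proof
      fix w
      assume "w \<in> closed_segment (id z) (of_real (Re z))"
      then obtain u where u: "0 \<le> u" "u \<le> 1" and w: "w = (1 - u) *\<^sub>R z + u *\<^sub>R of_real (Re z)"
        by (auto simp: in_segment)
      have "Re w = Re z" "Im w = (1 - u) * Im z"
        by (auto simp: w algebra_simps)
      moreover have "\<bar>(1 - u) * Im z\<bar> \<le> 1 * \<bar>Im z\<bar>"
        unfolding abs_mult using u by (intro mult_right_mono) auto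
      ultimately show "w \<in> ?C"
        using z by (force simp: mem_comb_domain)
    qed
  qed (auto intro!: continuous_intros)
  moreover have "homotopic_with_canon (\<lambda>_. True) ?C ?C (\<lambda>z. of_real (Re z)) (\<lambda>z. 0)"
  proof (rule homotopic_with_linear)
    fix z :: complex
    show "closed_segment (of_real (Re z)) 0 \<subseteq> ?C"
      using assms by (auto simp: mem_comb_domain in_segment)
  qed (auto intro!: continuous_intros)
  ultimately have "contractible ?C"
    unfolding contractible_def by (blast intro: homotopic_with_trans)
  then show ?thesis
    by (rule contractible_imp_simply_connected)
qed

text \<open>\<open>hardy_number\<close> picks its Riemann map by \<open>SOME\<close>, which carries
  information only once some Riemann map is known to exist.\<close>

lemma riemann_map_comb_domain:
  assumes "is_comb_domain C"
  shows "\<exists>f. riemann_map f C"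
proof -
  obtain x b \<delta> where xb: "strict_mono x" "\<delta> > 0" "\<And>n. x n - x (n - 1) \<ge> \<delta>" "\<And>n. b n > 0"
      and C: "C = comb_domain x b"
    using assms unfolding is_comb_domain_def by blast
  have "open C" "simply_connected C"
    using open_comb_domain[OF xb(1-3)] simply_connected_comb_domain[OF xb(4)] by (auto simp: C)
  \<comment> \<open>These two points exclude the empty set and the whole plane from the alternatives
    of the Riemann mapping theorem.\<close>
  moreover have "of_real (x 0) \<in> C" "Complex (x 0) (b 0) \<notin> C"
    using xb by (auto simp: C mem_comb_domain intro!: exI[of _ 0])
  ultimately obtain f g where "g holomorphic_on ball 0 1" "\<forall>z\<in>C. f z \<in> ball 0 1 \<and> g (f z) = z"
      "\<forall>z\<in>ball 0 1. g z \<in> C \<and> f (g z) = z"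
    using Riemann_mapping_theorem[of C] by blast
  then have "riemann_map g C"
    unfolding riemann_map_def by (auto intro: inj_on_inverseI) (metis image_eqI mem_ball_0)
  then show ?thesis
    by blast
qed

text \<open>Allowing \<open>q\<close> to exceed \<open>r\<close> gives room to keep the exponent
  positive and, later, to step past the exponents with
  \<open>cos (q * (pi / 2)) = 0\<close>.\<close>

lemma hardy_number_geI:
  assumes "\<And>r. ereal r < p \<Longrightarrow> \<exists>q\<ge>r. q > 0 \<and> in_hardy q (SOME f. riemann_map f C)"
  shows "p \<le> hardy_number C"
proof (rule dense_le)
  fix x
  assume x: "x < p"
  show "x \<le> hardy_number C"
  proof (cases x)
    case (real r)
    then obtain q where "q \<ge> r" "q > 0" "in_hardy q (SOME f. riemann_map f C)"
      using assms[of r] x by auto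
    then have "ereal q \<le> hardy_number C"
      unfolding hardy_number_def by (intro Sup_upper) auto
    then show ?thesis
      using \<open>q \<ge> r\<close> real by (metis ereal_less_eq(3) order_trans)
  qed (use x in auto)
qed

text \<open>Outside the two rays, \<open>1 + (f / b)\<^sup>2\<close> omits the negative axis, so its power \<open>p / 2 < 1 / 2\<close> takes values in a
  sector on which the real part is comparable to the modulus.\<close>

lemma in_hardy_of_omitted_rays:
  assumes hol: "f holomorphic_on ball 0 1" and b: "0 < b" and p: "0 < p" "p < 1"
    and omit: "\<And>z t. z \<in> ball 0 1 \<Longrightarrow> \<bar>t\<bar> \<ge> b \<Longrightarrow> f z \<noteq> Complex 0 t"
  shows "in_hardy p f"
proof -
  define v where "v = (\<lambda>z. 1 + (f z / of_real b)\<^sup>2)"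
  \<comment> \<open>The cosine at the edge of the sector: \<open>\<bar>Arg (v z)\<bar>\<close> is at
    most \<open>pi\<close>, so the power \<open>p / 2\<close> has argument at most
    \<open>p / 2 * pi < pi / 2\<close>.\<close>
  define c where "c = cos (p / 2 * pi)"
  have c: "c > 0"
    unfolding c_def using p by (intro cos_gt_zero) (auto simp: field_simps)
  have v: "v z \<notin> \<real>\<^sub>\<le>\<^sub>0" if z: "z \<in> ball 0 1" for z
  proof
    define w where "w = f z / of_real b"
    have fz: "f z = of_real b * w"
      using b by (simp add: w_def)
    have vz: "v z = 1 + w\<^sup>2"
      by (simp add: v_def w_def)
    assume "v z \<in> \<real>\<^sub>\<le>\<^sub>0"
    then have w2: "1 + (Re w)\<^sup>2 - (Im w)\<^sup>2 \<le> 0" "Re w * Im w = 0"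
      by (auto simp: vz complex_nonpos_Reals_iff power2_eq_square)
    have "Im w \<noteq> 0"
      using w2(1) by (smt (verit) zero_le_power2 zero_power2)
    then have "Re w = 0" "1 \<le> (Im w)\<^sup>2"
      using w2 by auto
    then have "f z = Complex 0 (b * Im w)" "\<bar>b * Im w\<bar> \<ge> b"
      using b by (auto simp: fz complex_eq_iff abs_mult abs_square_le_1 power2_eq_square)
         (metis abs_le_square_iff abs_one one_power2 power2_eq_square)
    then show False
      using omit z by metis
  qed
  define K where "K = b powr p * 2 powr (p / 2)"
  define H where "H = (\<lambda>z. of_real K * (v z powr of_real (p / 2) / of_real c + 1))"
  show ?thesis
  proof (rule in_hardy_harmonic_majorant)
    show "H holomorphic_on ball 0 1"
      unfolding H_def v_def using v c b by (intro holomorphic_intros hol) (auto simp: v_def)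
    fix z :: complex
    assume z: "z \<in> ball 0 1"
    have "v z \<noteq> 0"
      using v[OF z] by auto
    have cos_le: "cos (p / 2 * pi) \<le> cos \<bar>p / 2 * Arg (v z)\<bar>"
      using p Arg_bounded[of "v z"]
      by (intro cos_monotone_0_pi_le) (auto simp: abs_mult abs_le_iff intro!: mult_left_mono)
    have "c * norm (v z) powr (p / 2) \<le> Re (v z powr of_real (p / 2))"
      using mult_right_mono[OF cos_le, of "norm (v z) powr (p / 2)"]
      unfolding Re_powr_of_real[OF \<open>v z \<noteq> 0\<close>] c_def cos_abs_real by (simp only: mult.commute norm_ge_zero powr_ge_zero)
    then have le: "norm (v z) powr (p / 2) \<le> Re (v z powr of_real (p / 2)) / c"
      using c by (simp add: field_simps)
    \<comment> \<open>The square of \<open>norm (f z)\<close> is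
      \<open>b\<^sup>2 * norm (v z - 1)\<close> by the definition of \<open>v\<close>, and the
      exponent \<open>p / 2\<close> undoes the square.\<close>
    have "norm (f z) powr p = (b\<^sup>2 * norm (v z - 1)) powr (p / 2)"
      using b by (simp add: v_def norm_power norm_divide power_divide powr_half_sqrt flip: powr_powr)
         (simp add: powr_def ln_realpow)
    also have "\<dots> \<le> (b\<^sup>2 * (norm (v z) + 1)) powr (p / 2)"
      using p norm_triangle_ineq4[of "v z" 1] by (intro powr_mono2 mult_left_mono) auto
    also have "\<dots> = b powr p * (norm (v z) + 1) powr (p / 2)"
      using b by (simp add: powr_mult) (simp add: powr_def ln_realpow)
    also have "\<dots> \<le> b powr p * (2 powr (p / 2) * (norm (v z) powr (p / 2) + 1 powr (p / 2)))"
      using p by (intro mult_left_mono powr_add_le) auto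
    also have "\<dots> \<le> K * (Re (v z powr of_real (p / 2)) / c + 1)"
      unfolding K_def mult.assoc using le by (intro mult_left_mono add_mono) auto
    also have "\<dots> = Re (H z)"
      by (simp add: H_def)
    finally show "norm (f z) powr p \<le> Re (H z)" .
  qed (use hol p in auto)
qed

lemma hardy_number_comb_domain_ge_1:
  assumes "is_comb_domain C"
  shows "1 \<le> hardy_number C"
proof (rule hardy_number_geI)
  fix r
  assume "ereal r < 1"
  \<comment> \<open>The maximum keeps the exponent positive when \<open>r\<close> is not.\<close>
  define q where "q = max r (1 / 2)"
  have q: "0 < q" "q < 1" "r \<le> q"
    using \<open>ereal r < 1\<close> by (auto simp: q_def)
  obtain x b where xb: "x 0 = 0" "\<And>n. b n > 0" "C = comb_domain x b"
    using assms unfolding is_comb_domain_def by blast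
  define f where "f = (SOME f. riemann_map f C)"
  have f: "riemann_map f C"
    unfolding f_def using riemann_map_comb_domain[OF assms] by (rule someI_ex)
  have "f z \<noteq> Complex 0 t" if "z \<in> ball 0 1" "\<bar>t\<bar> \<ge> b 0" for z t
  proof
    assume "f z = Complex 0 t"
    then have "Complex 0 t \<in> comb_domain x b"
      using f that xb unfolding riemann_map_def by force
    then show False
      using that xb by (auto simp: mem_comb_domain dest!: spec[of _ 0])
  qed
  then have "in_hardy q f"
    using q xb f by (intro in_hardy_of_omitted_rays[of f "b 0"]) (auto simp: riemann_map_def)
  then show "\<exists>q\<ge>r. q > 0 \<and> in_hardy q (SOME f. riemann_map f C)"
    using q by (auto simp: f_def)
qed

section \<open>The complex arctangent on the right half-plane\<close>

lemma exp_Arctan: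
  assumes "1 + \<i> * s \<noteq> 0" "1 - \<i> * s \<noteq> 0"
  shows "exp (-2 * \<i> * Arctan s) * (1 + \<i> * s) = 1 - \<i> * s"
proof -
  have "exp (-2 * \<i> * Arctan s) = exp (Ln ((1 - \<i> * s) / (1 + \<i> * s)))"
    by (simp add: Arctan_def)
  then show ?thesis
    using assms by simp
qed

text \<open>\<open>w\<close> is the Cayley transform under the logarithm in \<open>Arctan\<close>.
  It sends the right half-plane into the lower half-plane and points with
  \<open>norm s \<ge> 1\<close> into \<open>Re w \<le> 0\<close>; the real part of
  \<open>Arctan s\<close> is minus half the argument of \<open>w\<close>.\<close>

lemma
  assumes "Re s > 0"
  shows Re_Arctan_pos: "0 < Re (Arctan s)"
    and Re_Arctan_less: "Re (Arctan s) < pi / 2"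
    and Re_Arctan_ge: "norm s \<ge> 1 \<Longrightarrow> pi / 4 \<le> Re (Arctan s)"
proof -
  define w where "w = (1 - \<i> * s) / (1 + \<i> * s)"
  have ne: "1 + \<i> * s \<noteq> 0"
    using assms by (auto simp: complex_eq_iff)
  have w: "w = (of_real (1 - (norm s)\<^sup>2) - 2 * \<i> * Re s) / of_real ((norm (1 + \<i> * s))\<^sup>2)"
  proof -
    have "w = (1 - \<i> * s) * cnj (1 + \<i> * s) / of_real ((norm (1 + \<i> * s))\<^sup>2)"
      using complex_div_cnj[of "1 - \<i> * s" "1 + \<i> * s"] by (simp add: w_def)
    also have "(1 - \<i> * s) * cnj (1 + \<i> * s) = of_real (1 - (norm s)\<^sup>2) - 2 * \<i> * Re s"
      by (simp only: of_real_diff complex_norm_square) (simp add: complex_eq_iff algebra_simps)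
    finally show ?thesis .
  qed
  have n: "0 < (norm (1 + \<i> * s))\<^sup>2"
    using ne by simp
  have Imw: "Im w < 0"
    using n assms unfolding w by (simp add: Im_divide_of_real divide_neg_pos del: of_real_power)
  then have "w \<noteq> 0"
    by auto
  have Re_A: "Re (Arctan s) = - Im (Ln w) / 2"
    by (simp add: Arctan_def w_def)
  have "Im (Ln w) < 0"
    using Im_Ln_pos_le[OF \<open>w \<noteq> 0\<close>] Im_Ln_le_pi[OF \<open>w \<noteq> 0\<close>] Imw by linarith
  then show "0 < Re (Arctan s)"
    by (simp add: Re_A)
  show "Re (Arctan s) < pi / 2"
    using mpi_less_Im_Ln[OF \<open>w \<noteq> 0\<close>] by (simp add: Re_A)
  show "pi / 4 \<le> Re (Arctan s)" if "norm s \<ge> 1"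
  proof -
    have "1 \<le> (norm s)\<^sup>2"
      using that by simp
    then have "Re w \<le> 0"
      using n unfolding w by (simp add: Re_divide_of_real divide_nonpos_pos del: of_real_power)
    then have "\<bar>Im (Ln w)\<bar> \<ge> pi / 2"
      using Re_Ln_pos_lt[OF \<open>w \<noteq> 0\<close>] by linarith
    then show ?thesis
      using \<open>Im (Ln w) < 0\<close> by (simp add: Re_A)
  qed
qed

lemma Re_Arctan_imaginary:
  assumes "Re s = 0" "norm s < 1"
  shows "Re (Arctan s) = 0"
proof -
  define y where "y = Im s"
  have s: "s = \<i> * y"
    using assms by (simp add: complex_eq_iff y_def)
  have y: "\<bar>y\<bar> < 1"
    using assms by (simp add: s norm_mult)
  have "(1 - \<i> * s) / (1 + \<i> * s) = of_real ((1 + y) / (1 - y))"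
    by (simp add: s)
  moreover have "0 < (1 + y) / (1 - y)"
    using y by (intro divide_pos_pos) auto
  ultimately show ?thesis
    by (simp add: Arctan_def Ln_of_real del: of_real_divide)
qed

lemma tan_Arctan_right_half_plane:
  assumes "Re s > 0"
  shows "tan (Arctan s) = s"
proof (rule tan_Arctan)
  show "s\<^sup>2 \<noteq> -1"
    using assms by (metis less_irrefl imaginary_unit.simps(1) power2_eq_iff power2_i uminus_complex.simps(1) neg_0_equal_iff_equal)
qed

text \<open>Both sides have tangent \<open>s\<close>, and the right side has real part between 0 and
  \<open>pi / 2\<close>, where \<open>Arctan\<close> inverts \<open>tan\<close>. The identity
  carries boundary points beyond the poles, which lie on the branch cuts, to points of modulus below
  1.\<close>

lemma Arctan_eq_pi_half_minus:
  assumes "Re s > 0"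
  shows "Arctan s = of_real (pi / 2) - Arctan (1 / s)"
proof -
  have inv: "Re (1 / s) > 0"
    using assms by (simp add: Re_complex_div_gt_0)
  define z where "z = of_real (pi / 2) - Arctan (1 / s)"
  have "sin (of_real (pi / 2) :: complex) = 1" "cos (of_real (pi / 2) :: complex) = 0"
    by (simp_all only: sin_of_real cos_of_real) simp_all
  then have "tan z = cos (Arctan (1 / s)) / sin (Arctan (1 / s))"
    by (simp add: z_def tan_def sin_diff cos_diff)
  also have "\<dots> = inverse (tan (Arctan (1 / s)))"
    by (simp add: tan_def)
  also have "\<dots> = s"
    using inv by (simp add: tan_Arctan_right_half_plane)
  finally have "tan z = s" .
  moreover have "Arctan (tan z) = z"
    using Re_Arctan_pos[OF inv] Re_Arctan_less[OF inv] by (intro Arctan_tan) (auto simp: z_def)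
  ultimately show ?thesis
    by (simp add: z_def)
qed

lemma Arctan_cnj:
  assumes "Re s > 0"
  shows "Arctan (cnj s) = cnj (Arctan s)"
proof -
  have "tan (cnj (Arctan s)) = cnj s"
    using tan_Arctan_right_half_plane[OF assms]
    by (metis tan_def complex_cnj_divide cnj_sin cnj_cos)
  moreover have "Arctan (tan (cnj (Arctan s))) = cnj (Arctan s)"
    using Re_Arctan_pos[OF assms] Re_Arctan_less[OF assms] by (intro Arctan_tan) auto
  ultimately show ?thesis
    by simp
qed

lemma norm_Arctan_le:
  assumes "norm s \<le> 1 / 2"
  shows "norm (Arctan s) \<le> 2 * norm s"
proof -
  have "norm (Arctan s - Arctan 0) \<le> 2 * norm (s - 0)"
  proof (rule field_differentiable_bound)
    show "convex (cball (0::complex) (1 / 2))"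
      by simp
    fix z :: complex
    assume z: "z \<in> cball 0 (1 / 2)"
    have "\<bar>Im z\<bar> < 1"
      using z abs_Im_le_cmod[of z] by (simp add: order_le_less_trans)
    then show "(Arctan has_field_derivative inverse (1 + z\<^sup>2)) (at z within cball 0 (1 / 2))"
      by (rule has_field_derivative_at_within[OF has_field_derivative_Arctan])
    have "norm (z\<^sup>2) \<le> (1 / 2)\<^sup>2"
      unfolding norm_power using z by (intro power_mono) auto
    then have "1 / 2 \<le> norm (1 + z\<^sup>2)"
      using norm_triangle_ineq2[of 1 "- z\<^sup>2"] by (simp add: power2_eq_square)
    then show "norm (inverse (1 + z\<^sup>2)) \<le> 2"
      using le_imp_inverse_le[of "1 / 2" "norm (1 + z\<^sup>2)"] by (simp add: norm_inverse)
  qed (use assms in auto)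
  then show ?thesis
    by simp
qed

text \<open>A bound on \<open>Arctan\<close> bounds \<open>exp\<close> of both multiples
  \<open>2 * \<i>\<close> and \<open>-2 * \<i>\<close> of it, so \<open>1 - \<i> * s\<close> and
  \<open>1 + \<i> * s\<close> stay comparable in modulus. In the limit exactly one of them
  vanishes.\<close>

lemma Arctan_not_bounded_near_pole:
  assumes s: "\<And>n. Re (s n) > 0" and lim: "s \<longlonglongrightarrow> a" and a: "Re a = 0" "\<bar>Im a\<bar> = 1"
  shows "\<not> (\<forall>n. norm (Arctan (s n)) \<le> B)"
proof
  assume B: "\<forall>n. norm (Arctan (s n)) \<le> B"
  have ne: "1 + \<i> * s n \<noteq> 0" "1 - \<i> * s n \<noteq> 0" for n
    using s[of n] by (auto simp: complex_eq_iff)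
  have n1: "norm (exp (-2 * \<i> * Arctan (s n))) \<le> exp (2 * B)" for n
  proof -
    have "norm (exp (-2 * \<i> * Arctan (s n))) \<le> exp (norm (-2 * \<i> * Arctan (s n)))"
      by (rule norm_exp)
    also have "\<dots> \<le> exp (2 * B)"
      using B by (simp add: norm_mult)
    finally show ?thesis .
  qed
  have n2: "norm (exp (2 * \<i> * Arctan (s n))) \<le> exp (2 * B)" for n
  proof -
    have "norm (exp (2 * \<i> * Arctan (s n))) \<le> exp (norm (2 * \<i> * Arctan (s n)))"
      by (rule norm_exp)
    also have "\<dots> \<le> exp (2 * B)"
      using B by (simp add: norm_mult)
    finally show ?thesis .
  qed
  have 1: "norm (1 - \<i> * s n) \<le> exp (2 * B) * norm (1 + \<i> * s n)" for n
    unfolding exp_Arctan[OF ne, symmetric] norm_mult using n1[of n] by (intro mult_right_mono) auto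
  have "exp (2 * \<i> * Arctan (s n)) * (1 - \<i> * s n) = 1 + \<i> * s n" for n
    unfolding exp_Arctan[OF ne, symmetric] by (simp add: mult.assoc[symmetric] flip: exp_add)
  then have 2: "norm (1 + \<i> * s n) \<le> exp (2 * B) * norm (1 - \<i> * s n)" for n
    using n2[of n] by (metis mult_right_mono norm_ge_zero norm_mult)
  have "norm (1 - \<i> * a) \<le> exp (2 * B) * norm (1 + \<i> * a)"
    by (rule LIMSEQ_le[of "\<lambda>n. norm (1 - \<i> * s n)" _ "\<lambda>n. exp (2 * B) * norm (1 + \<i> * s n)"])
       (use 1 in \<open>auto intro!: tendsto_intros lim\<close>)
  moreover have "norm (1 + \<i> * a) \<le> exp (2 * B) * norm (1 - \<i> * a)"
    by (rule LIMSEQ_le[of "\<lambda>n. norm (1 + \<i> * s n)" _ "\<lambda>n. exp (2 * B) * norm (1 - \<i> * s n)"])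
       (use 2 in \<open>auto intro!: tendsto_intros lim\<close>)
  moreover have "a = \<i> \<or> a = -\<i>"
    using a by (auto simp: complex_eq_iff)
  ultimately show False
    by auto
qed

text \<open>One \<open>L\<close> serves all sequences that approach \<open>a\<close> from the right
  half-plane. Limits replace the value at \<open>a\<close> because \<open>Arctan\<close> jumps
  across its cuts when \<open>norm a > 1\<close>; there the reflection \<open>1 / s\<close> is
  used.\<close>

lemma Arctan_boundary_limit:
  assumes "Re a = 0" "norm a \<noteq> 1"
  obtains L where "Re L = (if norm a < 1 then 0 else pi / 2)"
    "\<And>s. \<lbrakk>\<And>n. Re (s n) > 0; s \<longlonglongrightarrow> a\<rbrakk> \<Longrightarrow> (\<lambda>n. Arctan (s n)) \<longlonglongrightarrow> L"
proof (cases "norm a < 1")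
  case True
  have "\<bar>Im a\<bar> < 1"
    using True abs_Im_le_cmod[of a] by linarith
  then have "isCont Arctan a"
    by (intro continuous_at_Arctan)
  show ?thesis
  proof (rule that[of "Arctan a"])
    show "(\<lambda>n. Arctan (s n)) \<longlonglongrightarrow> Arctan a" if "\<And>n. Re (s n) > 0" "s \<longlonglongrightarrow> a" for s
      using isCont_tendsto_compose[OF \<open>isCont Arctan a\<close> that(2)] .
  qed (use True assms Re_Arctan_imaginary in auto)
next
  case False
  then have "norm a > 1"
    using assms by auto
  then have na: "norm (1 / a) < 1" "a \<noteq> 0"
    by (auto simp: norm_divide divide_less_eq)
  then have "\<bar>Im (1 / a)\<bar> < 1"
    using abs_Im_le_cmod[of "1 / a"] by linarith
  then have cont: "isCont Arctan (1 / a)"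
    by (intro continuous_at_Arctan)
  show ?thesis
  proof (rule that[of "of_real (pi / 2) - Arctan (1 / a)"])
    have "Re (1 / a) = 0"
      using assms by (simp add: Re_divide)
    then show "Re (of_real (pi / 2) - Arctan (1 / a)) = (if norm a < 1 then 0 else pi / 2)"
      using False na Re_Arctan_imaginary by auto
    show "(\<lambda>n. Arctan (s n)) \<longlonglongrightarrow> of_real (pi / 2) - Arctan (1 / a)"
      if "\<And>n. Re (s n) > 0" "s \<longlonglongrightarrow> a" for s
    proof -
      have "(\<lambda>n. 1 / s n) \<longlonglongrightarrow> 1 / a"
        using that na by (intro tendsto_intros) auto
      then have "(\<lambda>n. of_real (pi / 2) - Arctan (1 / s n)) \<longlonglongrightarrow> of_real (pi / 2) - Arctan (1 / a)"
        by (rule tendsto_diff[OF tendsto_const isCont_tendsto_compose[OF cont]])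
      then show ?thesis
        using Arctan_eq_pi_half_minus that(1) by simp
    qed
  qed
qed

section \<open>Monotonicity in the logarithmic coordinate\<close>

text \<open>The Noshiro-Warschawski univalence argument: along the segment from \<open>a\<close> to
  \<open>b\<close>, the function \<open>u\<close> has derivative
  \<open>(norm (b - a))\<^sup>2 * Re f'\<close>. The conclusion is linear in \<open>f\<close>, so it
  can be added over the terms of a series without differentiating the series.\<close>

lemma Re_mult_cnj_pos_of_Re_deriv_pos:
  assumes S: "convex S" and ab: "a \<in> S" "b \<in> S" "a \<noteq> b"
    and deriv: "\<And>z. z \<in> S \<Longrightarrow> (f has_field_derivative f' z) (at z)"
    and pos: "\<And>z. z \<in> S \<Longrightarrow> Re (f' z) > 0"
  shows "0 < Re ((f b - f a) * cnj (b - a))"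
proof -
  define \<gamma> where "\<gamma> = (\<lambda>t. a + of_real t * (b - a))"
  define u where "u = (\<lambda>t. Re (f (\<gamma> t) * cnj (b - a)))"
  have "u 0 < u 1"
  proof (rule DERIV_pos_imp_increasing[of 0 1 u])
    fix t :: real
    assume t: "0 \<le> t" "t \<le> 1"
    have "\<gamma> t = (1 - t) *\<^sub>R a + t *\<^sub>R b"
      by (simp add: \<gamma>_def scaleR_conv_of_real algebra_simps)
    then have mem: "\<gamma> t \<in> S"
      using S ab t unfolding convex_def by auto
    have "(\<gamma> has_vector_derivative (b - a)) (at t)"
      unfolding \<gamma>_def by (auto intro!: derivative_eq_intros)
    then have "((\<lambda>t. f (\<gamma> t)) has_vector_derivative (b - a) * f' (\<gamma> t)) (at t)"
      using field_vector_diff_chain_at[of \<gamma> "b - a" t f "f' (\<gamma> t)"] deriv[OF mem] by (simp add: o_def)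
    then have "((\<lambda>t. f (\<gamma> t) * cnj (b - a)) has_vector_derivative ((b - a) * f' (\<gamma> t)) * cnj (b - a)) (at t)"
      by (rule has_vector_derivative_mult_left)
    then have "(u has_vector_derivative Re (((b - a) * f' (\<gamma> t)) * cnj (b - a))) (at t)"
      unfolding u_def by (rule bounded_linear.has_vector_derivative[OF bounded_linear_Re])
    moreover have "Re (((b - a) * f' (\<gamma> t)) * cnj (b - a)) = (norm (b - a))\<^sup>2 * Re (f' (\<gamma> t))"
      by (simp add: cmod_power2) (simp add: power2_eq_square algebra_simps)
    ultimately have "(u has_real_derivative ((norm (b - a))\<^sup>2 * Re (f' (\<gamma> t)))) (at t)"
      by (simp only: has_real_derivative_iff_has_vector_derivative)
    then show "\<exists>y. (u has_real_derivative y) (at t) \<and> 0 < y"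
      using pos[OF mem] ab by (intro exI[of _ "(norm (b - a))\<^sup>2 * Re (f' (\<gamma> t))"]) auto
  qed auto
  then show ?thesis
    by (simp add: u_def \<gamma>_def algebra_simps)
qed

text \<open>The right half-plane in the coordinate \<open>ln s\<close>: it is convex, and
  \<open>s\<close> to \<open>1 / s\<close> becomes negation.\<close>

definition strip :: "complex set" where
  "strip = {z. \<bar>Im z\<bar> < pi / 2}"

lemma Re_exp_strip_pos:
  assumes "z \<in> strip"
  shows "Re (exp z) > 0"
  using assms by (auto simp: strip_def Re_exp intro!: mult_pos_pos cos_gt_zero_pi)

lemma Re_Arctan_exp_diff_pos:
  assumes "a \<in> strip" "b \<in> strip" "a \<noteq> b" "T > 0"
  shows "0 < Re ((Arctan (exp b / of_real T) - Arctan (exp a / of_real T)) * cnj (b - a))"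
proof (rule Re_mult_cnj_pos_of_Re_deriv_pos)
  have "strip = {z. Im z < pi / 2} \<inter> {z. Im z > - (pi / 2)}"
    by (auto simp: strip_def)
  then show "convex strip"
    by (elim ssubst) (intro convex_Int convex_halfspace_Im_lt convex_halfspace_Im_gt)
  fix z
  assume "z \<in> strip"
  define \<sigma> where "\<sigma> = exp z / of_real T"
  have \<sigma>: "Re \<sigma> > 0"
    using Re_exp_strip_pos[OF \<open>z \<in> strip\<close>] assms(4) by (simp add: \<sigma>_def Re_divide_of_real)
  show "((\<lambda>z. Arctan (exp z / of_real T)) has_field_derivative \<sigma> * inverse (1 + \<sigma>\<^sup>2)) (at z)"
    using \<sigma> assms(4) unfolding \<sigma>_def by (auto intro!: derivative_eq_intros)
  \<comment> \<open>The derivative is the reciprocal of \<open>\<sigma> + 1 / \<sigma>\<close>, a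
    sum of two points of the right half-plane.\<close>
  define \<tau> where "\<tau> = 1 / \<sigma> + \<sigma>"
  have "\<sigma> * inverse (1 + \<sigma>\<^sup>2) = 1 / \<tau>"
    using \<sigma> by (auto simp: \<tau>_def power2_eq_square divide_simps)
  moreover have "Re \<tau> > 0"
    using \<sigma> by (simp add: \<tau>_def Re_complex_div_gt_0 add_pos_pos)
  ultimately show "Re (\<sigma> * inverse (1 + \<sigma>\<^sup>2)) > 0"
    by (simp add: Re_complex_div_gt_0)
qed (use assms in auto)

section \<open>Series of arctangents\<close>

definition right_half_plane :: "complex set" where
  "right_half_plane = {s. Re s > 0}"

lemma open_right_half_plane: "open right_half_plane"
  by (simp add: right_half_plane_def open_halfspace_Re_gt)

lemma inverse_in_right_half_plane: "s \<in> right_half_plane \<Longrightarrow> 1 / s \<in> right_half_plane"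
  by (simp add: right_half_plane_def Re_complex_div_gt_0)

lemma divide_pow2_in_right_half_plane: "s \<in> right_half_plane \<Longrightarrow> s / 2 ^ k \<in> right_half_plane"
  using Re_divide_of_real[of s "2 ^ k"] by (simp add: right_half_plane_def)

text \<open>With \<open>Suc k\<close> in the exponent the closed unit disc is scaled into the disc
  of radius 1/2, where \<open>norm_Arctan_le\<close> applies, and the poles have modulus at least 2,
  so none lies on the unit circle.\<close>

definition arctan_sum :: "(nat \<Rightarrow> real) \<Rightarrow> complex \<Rightarrow> complex" where
  "arctan_sum c s = (\<Sum>k. of_real (c k) * Arctan (s / 2 ^ Suc k))"

locale arctan_series =
  fixes c :: "nat \<Rightarrow> real"
  assumes nonneg: "c k \<ge> 0"
    and summable_pow2: "summable (\<lambda>k. c k / 2 ^ k)"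
begin

text \<open>Dropping \<open>N\<close> terms and rescaling by \<open>2 ^ N\<close> leaves a series of
  the same kind. This reduces questions about \<open>norm s < 2 ^ N\<close> to finitely many terms
  and the unit disc.\<close>

lemma shifted: "arctan_series (\<lambda>k. c (k + N))"
proof
  have "summable (\<lambda>k. 2 ^ N * (c (k + N) / 2 ^ (k + N)))"
    using summable_pow2 by (intro summable_mult) (simp add: summable_iff_shift[where f = "\<lambda>k. c k / 2 ^ k"])
  then show "summable (\<lambda>k. c (k + N) / 2 ^ k)"
    by (simp add: power_add)
qed (rule nonneg)

lemma norm_term_le:
  assumes "norm s \<le> 1"
  shows "norm (of_real (c k) * Arctan (s / 2 ^ Suc k)) \<le> c k / 2 ^ k * norm s"
proof -
  have "norm (s / 2 ^ Suc k) \<le> 1 / 2"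
  proof -
    have "norm s \<le> 2 ^ k"
      using assms one_le_power[of "2::real" k] by linarith
    then show ?thesis
      by (simp add: norm_divide norm_mult norm_power field_simps)
  qed
  then have "norm (Arctan (s / 2 ^ Suc k)) \<le> 2 * norm (s / 2 ^ Suc k)"
    by (rule norm_Arctan_le)
  also have "\<dots> = norm s / 2 ^ k"
    by (simp add: norm_divide norm_mult norm_power)
  finally show ?thesis
    using nonneg[of k] by (simp add: norm_mult) (metis mult_left_mono times_divide_eq_right)
qed

lemma norm_term_le_unit:
  assumes "norm s \<le> 1"
  shows "norm (of_real (c k) * Arctan (s / 2 ^ Suc k)) \<le> c k / 2 ^ k"
  using norm_term_le[OF assms, of k] nonneg[of k] assms
  by (meson divide_nonneg_nonneg mult_left_le order_trans zero_le_power zero_le_numeral)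

text \<open>The Weierstrass test with majorant \<open>c k / 2 ^ k\<close>. The disc crosses the
  imaginary axis, and this is what makes tails of the series continuous at boundary points.\<close>

lemma holomorphic_unit_ball: "arctan_sum c holomorphic_on ball 0 1"
proof (rule holomorphic_uniform_sequence)
  show "(\<lambda>s. \<Sum>k<n. of_real (c k) * Arctan (s / 2 ^ Suc k)) holomorphic_on ball 0 1" for n
  proof (intro holomorphic_intros holomorphic_on_compose_gen[OF _ holomorphic_on_Arctan, unfolded o_def])
    fix k :: nat
    show "(\<lambda>s. s / 2 ^ Suc k) ` ball 0 1 \<subseteq> ball (0::complex) 1"
    proof (clarsimp simp: norm_divide norm_mult norm_power)
      fix s :: complex
      assume "norm s < 1"
      then show "norm s < 2 * 2 ^ k"
        using one_le_power[of "2::real" k] by linarith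
    qed
    fix z :: complex
    assume "z \<in> ball 0 1"
    then show "\<bar>Im z\<bar> < 1"
      using abs_Im_le_cmod[of z] by simp
  qed auto
  fix x :: complex
  assume x: "x \<in> ball 0 1"
  then obtain d where d: "d > 0" "cball x d \<subseteq> ball 0 1"
    using open_contains_cball[of "ball (0::complex) 1"] open_ball by blast
  have "uniform_limit (cball x d) (\<lambda>n s. \<Sum>k<n. of_real (c k) * Arctan (s / 2 ^ Suc k)) (arctan_sum c) sequentially"
    unfolding arctan_sum_def
  proof (rule Weierstrass_m_test[OF _ summable_pow2])
    fix n s
    assume "s \<in> cball x d"
    then have "s \<in> ball 0 1"
      using d(2) by blast
    then show "norm (of_real (c n) * Arctan (s / 2 ^ Suc n)) \<le> c n / 2 ^ n"
      by (intro norm_term_le_unit) auto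
  qed
  then show "\<exists>d>0. cball x d \<subseteq> ball 0 1 \<and>
      uniform_limit (cball x d) (\<lambda>n s. \<Sum>k<n. of_real (c k) * Arctan (s / 2 ^ Suc k)) (arctan_sum c) sequentially"
    using d by blast
qed auto

lemma summable_terms: "summable (\<lambda>k. of_real (c k) * Arctan (s / 2 ^ Suc k))"
proof -
  obtain N where N: "norm s < 2 ^ N"
    using real_arch_pow[of 2 "norm s"] by auto
  interpret shift: arctan_series "\<lambda>k. c (k + N)"
    by (rule shifted)
  have "norm (s / 2 ^ N) \<le> 1"
    using N by (simp add: norm_divide norm_power)
  then have "summable (\<lambda>k. of_real (c (k + N)) * Arctan ((s / 2 ^ N) / 2 ^ Suc k))"
    by (intro summable_comparison_test[OF _ shift.summable_pow2] exI[of _ 0]) (use shift.norm_term_le_unit in blast)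
  then show ?thesis
    by (subst summable_iff_shift[of _ N, symmetric]) (simp add: power_add field_simps)
qed

lemma arctan_sum_split:
  "arctan_sum c s = (\<Sum>k<N. of_real (c k) * Arctan (s / 2 ^ Suc k)) + arctan_sum (\<lambda>k. c (k + N)) (s / 2 ^ N)"
  unfolding arctan_sum_def suminf_split_initial_segment[OF summable_terms, of s N]
  by (simp add: power_add field_simps)

lemma holomorphic_half_plane: "arctan_sum c holomorphic_on right_half_plane"
proof -
  have "arctan_sum c field_differentiable at a" if a: "a \<in> right_half_plane" for a
  proof -
    obtain N where N: "norm a < 2 ^ N"
      using real_arch_pow[of 2 "norm a"] by auto
    interpret shift: arctan_series "\<lambda>k. c (k + N)"
      by (rule shifted)
    \<comment> \<open>On this piece the first \<open>N\<close> terms live on the half-plane, which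
      meets no cut of \<open>Arctan\<close>, and the rescaled tail lives on the unit disc.\<close>
    let ?U = "right_half_plane \<inter> ball 0 (2 ^ N)"
    have "(\<lambda>s. (\<Sum>k<N. of_real (c k) * Arctan (s / 2 ^ Suc k)) + arctan_sum (\<lambda>k. c (k + N)) (s / 2 ^ N)) holomorphic_on ?U"
    proof (intro holomorphic_intros holomorphic_on_compose_gen[OF _ holomorphic_on_Arctan, unfolded o_def]
         holomorphic_on_compose_gen[OF _ shift.holomorphic_unit_ball, unfolded o_def])
      fix k :: nat
      show "(\<lambda>s. s / 2 ^ Suc k) ` ?U \<subseteq> right_half_plane"
        using divide_pow2_in_right_half_plane by blast
    next
      show "(\<lambda>s. s / 2 ^ N) ` ?U \<subseteq> ball 0 1"
        by (auto simp: norm_divide norm_power)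
    qed (auto simp: right_half_plane_def)
    then have "arctan_sum c holomorphic_on ?U"
      by (simp only: arctan_sum_split[of _ N, symmetric] eta_contract_eq)
    then show ?thesis
      by (rule holomorphic_on_imp_differentiable_at) (use a N open_right_half_plane in auto)
  qed
  then show ?thesis
    by (simp add: holomorphic_on_def field_differentiable_at_within)
qed

lemma Re_summable: "summable (\<lambda>k. c k * Re (Arctan (s / 2 ^ Suc k)))"
  using summable_Re[OF summable_terms[of s]] by simp

lemma Re_arctan_sum: "Re (arctan_sum c s) = (\<Sum>k. c k * Re (Arctan (s / 2 ^ Suc k)))"
  unfolding arctan_sum_def by (subst Re_suminf[OF summable_terms]) simp

lemma Re_arctan_sum_imaginary:
  assumes "Re a = 0" "norm a < 1"
  shows "Re (arctan_sum c a) = 0"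
proof -
  have "Re (Arctan (a / 2 ^ Suc k)) = 0" for k
  proof (rule Re_Arctan_imaginary)
    show "Re (a / 2 ^ Suc k) = 0"
      using assms Re_divide_of_real[of a "2 ^ Suc k"] by simp
    have "norm a < 2 * 2 ^ k"
      using assms one_le_power[of "2::real" k] by linarith
    then show "norm (a / 2 ^ Suc k) < 1"
      by (simp add: norm_divide norm_mult norm_power)
  qed
  then show ?thesis
    by (simp add: Re_arctan_sum)
qed

lemma Re_arctan_term_nonneg:
  assumes "s \<in> right_half_plane"
  shows "0 \<le> c k * Re (Arctan (s / 2 ^ Suc k))"
  using Re_Arctan_pos[of "s / 2 ^ Suc k"] divide_pow2_in_right_half_plane[OF assms, of "Suc k"] nonneg[of k]
  by (simp add: right_half_plane_def)

text \<open>A term with \<open>2 ^ Suc k \<le> norm s\<close> has passed its pole and contributes at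
  least \<open>pi / 4 * c k\<close>; the other terms are nonnegative.\<close>

lemma Re_arctan_sum_ge:
  assumes "s \<in> right_half_plane" "norm s \<ge> 2 ^ n"
  shows "pi / 4 * (\<Sum>k<n. c k) \<le> Re (arctan_sum c s)"
proof -
  have "pi / 4 * (\<Sum>k<n. c k) \<le> (\<Sum>k<n. c k * Re (Arctan (s / 2 ^ Suc k)))"
    unfolding sum_distrib_left
  proof (rule sum_mono)
    fix k
    assume "k \<in> {..<n}"
    then have "2 ^ Suc k \<le> (2::real) ^ n"
      by (intro power_increasing) auto
    then have "2 ^ Suc k \<le> norm s"
      using assms(2) by linarith
    then have "norm (s / 2 ^ Suc k) \<ge> 1"
      by (simp add: norm_divide norm_mult norm_power)
    then have "pi / 4 \<le> Re (Arctan (s / 2 ^ Suc k))"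
      using divide_pow2_in_right_half_plane[OF assms(1), of "Suc k"]
      by (intro Re_Arctan_ge) (auto simp: right_half_plane_def)
    then show "pi / 4 * c k \<le> c k * Re (Arctan (s / 2 ^ Suc k))"
      using nonneg[of k] by (subst mult.commute) (intro mult_left_mono)
  qed
  also have "\<dots> \<le> Re (arctan_sum c s)"
    unfolding Re_arctan_sum using Re_summable Re_arctan_term_nonneg[OF assms(1)]
    by (intro sum_le_suminf) auto
  finally show ?thesis .
qed

lemma norm_arctan_sum_le:
  assumes "norm s \<le> 1"
  shows "norm (arctan_sum c s) \<le> (\<Sum>k. c k / 2 ^ k)"
  unfolding arctan_sum_def
  using summable_norm_comparison_test[of "\<lambda>k. of_real (c k) * Arctan (s / 2 ^ Suc k)" "\<lambda>k. c k / 2 ^ k"]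
    norm_term_le_unit[OF assms] summable_pow2
  by (intro norm_suminf_le) auto

lemma arctan_sum_of_real: "arctan_sum c (of_real r) = of_real (\<Sum>k. c k * arctan (r / 2 ^ Suc k))"
proof -
  have "of_real (c k) * Arctan (of_real r / 2 ^ Suc k) = of_real (c k * arctan (r / 2 ^ Suc k))" for k
    using Arctan_of_real[of "r / 2 ^ Suc k"] by simp
  then show ?thesis
    using summable_terms[of "of_real r"] unfolding arctan_sum_def
    by (simp only: summable_complex_of_real suminf_of_real[symmetric])
qed

lemma arctan_sum_cnj:
  assumes "s \<in> right_half_plane"
  shows "arctan_sum c (cnj s) = cnj (arctan_sum c s)"
proof -
  have "of_real (c k) * Arctan (cnj s / 2 ^ Suc k) = cnj (of_real (c k) * Arctan (s / 2 ^ Suc k))" for k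
    using Arctan_cnj[of "s / 2 ^ Suc k"] divide_pow2_in_right_half_plane[OF assms, of "Suc k"]
    by (simp add: right_half_plane_def)
  then show ?thesis
    unfolding arctan_sum_def by (simp only: bounded_linear.suminf[OF bounded_linear_cnj summable_terms])
qed

section \<open>Boundary behaviour of the series on the imaginary axis\<close>

lemma term_tendsto:
  assumes "Re a = 0" "norm a \<noteq> 2 ^ Suc k"
  obtains L where "Re L = (if norm a < 2 ^ Suc k then 0 else pi / 2)"
    "\<And>s. \<lbrakk>\<And>j. s j \<in> right_half_plane; s \<longlonglongrightarrow> a\<rbrakk> \<Longrightarrow> (\<lambda>j. Arctan (s j / 2 ^ Suc k)) \<longlonglongrightarrow> L"
proof -
  have "Re (a / 2 ^ Suc k) = 0"
    using assms Re_divide_of_real[of a "2 ^ Suc k"] by simp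
  moreover have na: "norm (a / 2 ^ Suc k) = norm a / 2 ^ Suc k"
    by (simp add: norm_divide norm_mult norm_power)
  moreover have "norm a / 2 ^ Suc k \<noteq> 1"
    using assms by (simp add: field_simps)
  ultimately obtain L where L: "Re L = (if norm a / 2 ^ Suc k < 1 then 0 else pi / 2)"
    "\<And>s. \<lbrakk>\<And>n. Re (s n) > 0; s \<longlonglongrightarrow> a / 2 ^ Suc k\<rbrakk> \<Longrightarrow> (\<lambda>n. Arctan (s n)) \<longlonglongrightarrow> L"
    using Arctan_boundary_limit[of "a / 2 ^ Suc k"] by metis
  show ?thesis
  proof (rule that)
    show "Re L = (if norm a < 2 ^ Suc k then 0 else pi / 2)"
      using L(1) by (simp add: divide_less_eq)
    show "(\<lambda>j. Arctan (s j / 2 ^ Suc k)) \<longlonglongrightarrow> L" if "\<And>j. s j \<in> right_half_plane" "s \<longlonglongrightarrow> a" for s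
      using divide_pow2_in_right_half_plane[OF that(1), of _ "Suc k"] that(2)
      by (intro L(2)) (auto simp: right_half_plane_def intro!: tendsto_intros)
  qed
qed

lemma tail_tendsto:
  assumes "s \<longlonglongrightarrow> a" "norm a < 2 ^ N"
  shows "(\<lambda>j. arctan_sum (\<lambda>k. c (k + N)) (s j / 2 ^ N)) \<longlonglongrightarrow> arctan_sum (\<lambda>k. c (k + N)) (a / 2 ^ N)"
proof -
  interpret shift: arctan_series "\<lambda>k. c (k + N)"
    by (rule shifted)
  have "isCont (arctan_sum (\<lambda>k. c (k + N))) (a / 2 ^ N)"
    using holomorphic_on_imp_continuous_on[OF shift.holomorphic_unit_ball] assms(2)
    by (simp add: continuous_on_eq_continuous_at norm_divide norm_power)
  then show ?thesis
    by (rule isCont_tendsto_compose) (use assms in \<open>auto intro!: tendsto_intros\<close>)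
qed

text \<open>This is the step function: each of the first \<open>n\<close> terms has passed its pole
  and contributes \<open>pi / 2 * c k\<close>, while the remaining terms are purely imaginary in the
  limit.\<close>

lemma boundary_limit:
  assumes "Re a = 0" "norm a < 2 ^ Suc n" "\<And>k. k < n \<Longrightarrow> norm a > 2 ^ Suc k"
  obtains L where "Re L = pi / 2 * (\<Sum>k<n. c k)"
    "\<And>s. \<lbrakk>\<And>j. s j \<in> right_half_plane; s \<longlonglongrightarrow> a\<rbrakk> \<Longrightarrow> (\<lambda>j. arctan_sum c (s j)) \<longlonglongrightarrow> L"
proof -
  interpret shift: arctan_series "\<lambda>k. c (k + Suc n)"
    by (rule shifted)
  have "\<exists>L. Re L = (if k < n then pi / 2 else 0) \<and>
      (\<forall>s. (\<forall>j. s j \<in> right_half_plane) \<longrightarrow> s \<longlonglongrightarrow> a \<longrightarrow> (\<lambda>j. Arctan (s j / 2 ^ Suc k)) \<longlonglongrightarrow> L)"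
    if "k < Suc n" for k
  proof -
    have ne: "norm a \<noteq> 2 ^ Suc k" and "norm a < 2 ^ Suc k \<longleftrightarrow> \<not> k < n"
      using assms(2) assms(3)[of k] that by (auto simp: less_Suc_eq)
    then show ?thesis
      using term_tendsto[OF assms(1) ne] by metis
  qed
  then obtain L where L: "\<And>k. k < Suc n \<Longrightarrow> Re (L k) = (if k < n then pi / 2 else 0)"
    "\<And>k s. \<lbrakk>k < Suc n; \<forall>j. s j \<in> right_half_plane; s \<longlonglongrightarrow> a\<rbrakk> \<Longrightarrow> (\<lambda>j. Arctan (s j / 2 ^ Suc k)) \<longlonglongrightarrow> L k"
    by metis
  \<comment> \<open>The split comes after \<open>Suc n\<close> terms, since
    \<open>norm a < 2 ^ Suc n\<close> is what puts the rescaled point inside the unit disc; term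
    \<open>n\<close> itself still has limit with real part 0.\<close>
  let ?L = "(\<Sum>k<Suc n. of_real (c k) * L k) + arctan_sum (\<lambda>k. c (k + Suc n)) (a / 2 ^ Suc n)"
  show ?thesis
  proof (rule that[of ?L])
    have "Re (arctan_sum (\<lambda>k. c (k + Suc n)) (a / 2 ^ Suc n)) = 0"
      using assms(1,2) Re_divide_of_real[of a "2 ^ Suc n"]
      by (intro shift.Re_arctan_sum_imaginary) (auto simp: norm_divide norm_mult norm_power)
    moreover have "(\<Sum>k<Suc n. c k * Re (L k)) = pi / 2 * (\<Sum>k<n. c k)"
      using L(1) by (simp add: sum_distrib_left mult.commute)
    ultimately show "Re ?L = pi / 2 * (\<Sum>k<n. c k)"
      by simp
    show "(\<lambda>j. arctan_sum c (s j)) \<longlonglongrightarrow> ?L" if "\<And>j. s j \<in> right_half_plane" "s \<longlonglongrightarrow> a" for s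
      unfolding arctan_sum_split[of _ "Suc n"]
      using that L(2) tail_tendsto[OF that(2) assms(2)] by (intro tendsto_add tendsto_sum tendsto_mult tendsto_const) auto
  qed
qed

text \<open>Only term \<open>m\<close> is singular at \<open>a\<close>. If the sum converged,
  subtracting the other convergent terms and the tail would bound \<open>Arctan\<close> near its
  pole.\<close>

lemma divergent_at_pole:
  assumes a: "Re a = 0" "norm a = 2 ^ Suc m" and pos: "c m > 0"
    and s: "\<And>j. s j \<in> right_half_plane" "s \<longlonglongrightarrow> a"
  shows "\<not> convergent (\<lambda>j. arctan_sum c (s j))"
proof
  assume conv: "convergent (\<lambda>j. arctan_sum c (s j))"
  define N where "N = Suc (Suc m)"
  have "norm a < 2 ^ N"
    by (simp add: a N_def)
  have tail: "convergent (\<lambda>j. arctan_sum (\<lambda>k. c (k + N)) (s j / 2 ^ N))"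
    using tail_tendsto[OF s(2) \<open>norm a < 2 ^ N\<close>] by (auto simp: convergent_def)
  have other: "convergent (\<lambda>j. of_real (c k) * Arctan (s j / 2 ^ Suc k))" if "k \<noteq> m" for k
  proof -
    have "norm a \<noteq> 2 ^ Suc k"
      using that a by simp
    then obtain L where "(\<lambda>j. Arctan (s j / 2 ^ Suc k)) \<longlonglongrightarrow> L"
      using term_tendsto[OF a(1)] s by metis
    then show ?thesis
      by (auto intro!: convergentI tendsto_intros)
  qed
  have "(\<lambda>j. arctan_sum c (s j) - arctan_sum (\<lambda>k. c (k + N)) (s j / 2 ^ N)
      - (\<Sum>k\<in>{..<N} - {m}. of_real (c k) * Arctan (s j / 2 ^ Suc k)))
      = (\<lambda>j. of_real (c m) * Arctan (s j / 2 ^ Suc m))"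
    unfolding arctan_sum_split[of _ N] by (subst sum.remove[of _ m]) (auto simp: N_def)
  moreover have "convergent (\<lambda>j. arctan_sum c (s j) - arctan_sum (\<lambda>k. c (k + N)) (s j / 2 ^ N)
      - (\<Sum>k\<in>{..<N} - {m}. of_real (c k) * Arctan (s j / 2 ^ Suc k)))"
    using conv tail other by (intro convergent_diff convergent_sum) auto
  ultimately have "convergent (\<lambda>j. of_real (c m) * Arctan (s j / 2 ^ Suc m))"
    by simp
  then have "Bseq (\<lambda>j. of_real (c m) * Arctan (s j / 2 ^ Suc m))"
    by (rule convergent_imp_Bseq)
  then obtain B where "\<And>j. norm (of_real (c m) * Arctan (s j / 2 ^ Suc m)) \<le> B"
    by (auto simp: Bseq_def)
  then have "\<forall>j. norm (Arctan (s j / 2 ^ Suc m)) \<le> B / c m"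
    using pos by (simp add: norm_mult field_simps)
  moreover have "\<not> (\<forall>j. norm (Arctan (s j / 2 ^ Suc m)) \<le> B / c m)"
  proof (rule Arctan_not_bounded_near_pole)
    show "0 < Re (s j / 2 ^ Suc m)" for j
      using divide_pow2_in_right_half_plane[OF s(1), of j "Suc m"] by (simp add: right_half_plane_def)
    show "(\<lambda>j. s j / 2 ^ Suc m) \<longlonglongrightarrow> a / 2 ^ Suc m"
      by (intro tendsto_intros s) auto
    show "Re (a / 2 ^ Suc m) = 0"
      using a Re_divide_of_real[of a "2 ^ Suc m"] by simp
    have "\<bar>Im a\<bar> = 2 ^ Suc m"
      using a by (simp add: cmod_eq_Im)
    then show "\<bar>Im (a / 2 ^ Suc m)\<bar> = 1"
      using Im_divide_of_real[of a "2 ^ Suc m"] by simp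
  qed
  ultimately show False
    by blast
qed

text \<open>The positivity for single terms is summed, using linearity of the pairing with
  \<open>cnj (b - a)\<close>.\<close>

lemma Re_arctan_sum_exp_diff_pos:
  assumes "a \<in> strip" "b \<in> strip" "a \<noteq> b" "\<And>k. c k > 0"
  shows "0 < Re ((arctan_sum c (exp b) - arctan_sum c (exp a)) * cnj (b - a))"
proof -
  let ?t = "\<lambda>k. (of_real (c k) * Arctan (exp b / 2 ^ Suc k) - of_real (c k) * Arctan (exp a / 2 ^ Suc k)) * cnj (b - a)"
  have sums: "summable ?t"
    by (intro summable_mult2 summable_diff summable_terms)
  have "(arctan_sum c (exp b) - arctan_sum c (exp a)) * cnj (b - a) = suminf ?t"
    unfolding arctan_sum_def
    by (subst suminf_diff[OF summable_terms summable_terms],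
        rule suminf_mult2[OF summable_diff[OF summable_terms summable_terms]])
  then have "Re ((arctan_sum c (exp b) - arctan_sum c (exp a)) * cnj (b - a)) = (\<Sum>k. Re (?t k))"
    by (simp only: Re_suminf[OF sums])
  also have "\<dots> > 0"
  proof (rule suminf_pos)
    show "summable (\<lambda>k. Re (?t k))"
      by (rule summable_Re[OF sums])
    fix k
    have "?t k = of_real (c k) * ((Arctan (exp b / of_real (2 ^ Suc k)) - Arctan (exp a / of_real (2 ^ Suc k))) * cnj (b - a))"
      by (simp add: algebra_simps)
    then have "Re (?t k) = c k * Re ((Arctan (exp b / of_real (2 ^ Suc k)) - Arctan (exp a / of_real (2 ^ Suc k))) * cnj (b - a))"
      by (simp only: Re_complex_of_real complex.sel times_complex.sel Im_complex_of_real)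
    then show "0 < Re (?t k)"
      using Re_Arctan_exp_diff_pos[OF assms(1-3), of "2 ^ Suc k"] assms(4)[of k] by simp
  qed
  finally show ?thesis .
qed

end

section \<open>The conformal map onto a comb domain\<close>

definition comb_fun :: "(nat \<Rightarrow> real) \<Rightarrow> complex \<Rightarrow> complex" where
  "comb_fun c s = arctan_sum c s - arctan_sum c (1 / s)"

text \<open>\<open>nat\<close> sends negative integers to 0, so at least one of the two sums is
  empty and the formula is odd in \<open>n\<close>.\<close>

definition comb_abscissa :: "(nat \<Rightarrow> real) \<Rightarrow> int \<Rightarrow> real" where
  "comb_abscissa c n = pi / 2 * (\<Sum>k<nat n. c k) - pi / 2 * (\<Sum>k<nat (- n). c k)"

definition cayley :: "complex \<Rightarrow> complex" where
  "cayley z = (1 + z) / (1 - z)"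

lemma holomorphic_cayley: "cayley holomorphic_on ball 0 1"
  unfolding cayley_def by (intro holomorphic_intros) auto

lemma cayley_in_right_half_plane:
  assumes "z \<in> ball 0 1"
  shows "cayley z \<in> right_half_plane"
proof -
  have "(norm z)\<^sup>2 < 1"
    using assms by (simp add: abs_square_less_1)
  then have "0 < Re ((1 + z) * cnj (1 - z))"
    unfolding cmod_power2 by (simp add: power2_eq_square algebra_simps)
  then show ?thesis
    by (simp only: cayley_def right_half_plane_def mem_Collect_eq Re_complex_div_gt_0)
qed

lemma inverse_cayley:
  assumes "s \<in> right_half_plane"
  shows "(s - 1) / (s + 1) \<in> ball 0 1" "cayley ((s - 1) / (s + 1)) = s"
proof -
  have s: "Re s > 0"
    using assms by (simp add: right_half_plane_def)
  then have ne: "s + 1 \<noteq> 0"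
    by (auto simp: complex_eq_iff)
  have "(norm (s - 1))\<^sup>2 < (norm (s + 1))\<^sup>2"
    unfolding cmod_power2 using s by (simp add: power2_eq_square algebra_simps)
  then have "norm (s - 1) < norm (s + 1)"
    by (rule power_less_imp_less_base) auto
  then show "(s - 1) / (s + 1) \<in> ball 0 1"
    using ne by (simp add: norm_divide)
  show "cayley ((s - 1) / (s + 1)) = s"
    using ne by (simp add: cayley_def divide_simps)
qed

lemma inj_on_cayley: "inj_on cayley (ball 0 1)"
proof (rule inj_on_inverseI)
  fix z :: complex
  assume "z \<in> ball 0 1"
  then have "1 - z \<noteq> 0"
    by auto
  then show "(cayley z - 1) / (cayley z + 1) = z"
    by (simp add: cayley_def divide_simps)
qed

lemma cayley_image: "cayley ` ball 0 1 = right_half_plane"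
  using cayley_in_right_half_plane inverse_cayley by (auto intro!: image_eqI[OF sym])

lemma comb_fun_inverse: "comb_fun c (1 / s) = - comb_fun c s"
  by (simp add: comb_fun_def)

lemma comb_abscissa_uminus: "comb_abscissa c (- n) = - comb_abscissa c n"
  by (simp add: comb_abscissa_def)

text \<open>The bound \<open>c0\<close> keeps the gaps between abscissae away from 0 and forces the
  partial sums of \<open>c\<close> to diverge, so that the image reaches arbitrarily far in the real
  direction.\<close>

locale comb_map = arctan_series c for c :: "nat \<Rightarrow> real" +
  fixes c0 :: real
  assumes c0: "c0 > 0" and c_ge: "c k \<ge> c0"
begin

lemma c_pos: "c k > 0"
  using c0 c_ge[of k] by linarith

lemma comb_abscissa_gap: "comb_abscissa c n - comb_abscissa c (n - 1) \<ge> pi / 2 * c0"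
proof (cases "n \<ge> 1")
  case True
  then have "nat n = Suc (nat (n - 1))" "nat (- n) = 0" "nat (- (n - 1)) = 0"
    by auto
  then show ?thesis
    using c_ge[of "nat (n - 1)"] by (simp add: comb_abscissa_def algebra_simps)
next
  case False
  then have "nat (- (n - 1)) = Suc (nat (- n))" "nat n = 0" "nat (n - 1) = 0"
    by auto
  then show ?thesis
    using c_ge[of "nat (- n)"] by (simp add: comb_abscissa_def algebra_simps)
qed

lemma strict_mono_comb_abscissa: "strict_mono (comb_abscissa c)"
proof (rule strict_monoI)
  fix m n :: int
  assume "m < n"
  then show "comb_abscissa c m < comb_abscissa c n"
  proof (induction n rule: int_gr_induct)
    case base
    then show ?case
      using comb_abscissa_gap[of "m + 1"] c0 pi_gt_zero by (smt (verit) add_diff_cancel_right' mult_pos_pos half_gt_zero)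
  next
    case (step n)
    then show ?case
      using comb_abscissa_gap[of "n + 1"] c0 pi_gt_zero by (smt (verit) add_diff_cancel_right' mult_pos_pos half_gt_zero)
  qed
qed

lemma holomorphic_comb_fun: "comb_fun c holomorphic_on right_half_plane"
  unfolding comb_fun_def
proof (intro holomorphic_intros holomorphic_on_compose_gen[OF _ holomorphic_half_plane, unfolded o_def] holomorphic_half_plane)
  show "(\<lambda>s. 1 / s) ` right_half_plane \<subseteq> right_half_plane"
    using inverse_in_right_half_plane by blast
qed (auto simp: right_half_plane_def)

text \<open>In the coordinate \<open>ln s\<close> both \<open>arctan_sum c (exp z)\<close> and
  \<open>- arctan_sum c (exp (- z))\<close> are monotone in the sense of the pairing with
  \<open>cnj (b - a)\<close>, hence so is their sum.\<close>

lemma inj_on_comb_fun: "inj_on (comb_fun c) right_half_plane"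
proof (rule inj_onI, rule ccontr)
  fix s t
  assume st: "s \<in> right_half_plane" "t \<in> right_half_plane" "comb_fun c s = comb_fun c t" "s \<noteq> t"
  define a where "a = Ln s"
  define b where "b = Ln t"
  have nz: "s \<noteq> 0" "t \<noteq> 0"
    using st by (auto simp: right_half_plane_def)
  have exp: "exp a = s" "exp b = t"
    using nz by (simp_all add: a_def b_def)
  have strip: "a \<in> strip" "b \<in> strip" "- a \<in> strip" "- b \<in> strip"
    using st Re_Ln_pos_lt[OF nz(1)] Re_Ln_pos_lt[OF nz(2)]
    by (auto simp: strip_def a_def b_def right_half_plane_def)
  have ab: "a \<noteq> b" "- a \<noteq> - b"
    using exp st by auto
  have "0 < Re ((arctan_sum c (exp b) - arctan_sum c (exp a)) * cnj (b - a))"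
    "0 < Re ((arctan_sum c (exp (- b)) - arctan_sum c (exp (- a))) * cnj (- b - (- a)))"
    using Re_arctan_sum_exp_diff_pos[OF strip(1,2) ab(1) c_pos] Re_arctan_sum_exp_diff_pos[OF strip(3,4) ab(2) c_pos]
    by blast+
  then have "0 < Re ((arctan_sum c (exp b) - arctan_sum c (exp a)) * cnj (b - a)) +
    Re ((arctan_sum c (exp (- b)) - arctan_sum c (exp (- a))) * cnj (- b - (- a)))"
    by (rule add_pos_pos)
  also have "\<dots> = Re ((comb_fun c t - comb_fun c s) * cnj (b - a))"
    by (simp add: comb_fun_def exp_minus exp inverse_eq_divide algebra_simps)
  finally show False
    using st by simp
qed

lemma comb_fun_cnj: "s \<in> right_half_plane \<Longrightarrow> comb_fun c (cnj s) = cnj (comb_fun c s)"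
  using arctan_sum_cnj[of s] arctan_sum_cnj[of "1 / s"] inverse_in_right_half_plane[of s]
  by (simp add: comb_fun_def)

definition tail_bound :: real where
  "tail_bound = (\<Sum>k. c k / 2 ^ k)"

lemma Re_comb_fun_ge:
  assumes "s \<in> right_half_plane" "norm s \<ge> 2 ^ n"
  shows "pi / 4 * (\<Sum>k<n. c k) - tail_bound \<le> Re (comb_fun c s)"
proof -
  have "norm s \<ge> 1"
    using assms(2) one_le_power[of "2::real" n] by linarith
  then have "norm (1 / s) \<le> 1"
    by (simp add: norm_divide divide_le_eq)
  then have "Re (arctan_sum c (1 / s)) \<le> tail_bound"
    unfolding tail_bound_def using norm_arctan_sum_le complex_Re_le_cmod order_trans by blast
  then show ?thesis
    using Re_arctan_sum_ge[OF assms] by (simp add: comb_fun_def)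
qed

text \<open>Together with the symmetry under \<open>1 / s\<close>, this keeps preimages of bounded
  sets away from 0 and from infinity.\<close>

lemma Re_comb_fun_large: "\<exists>R>1. \<forall>s\<in>right_half_plane. norm s \<ge> R \<longrightarrow> Re (comb_fun c s) \<ge> M"
proof -
  obtain n where n: "(M + tail_bound) / (pi / 4 * c0) \<le> real n"
    using real_arch_simple by blast
  have "pi / 4 * c0 > 0"
    using c0 by simp
  then have "M + tail_bound \<le> pi / 4 * c0 * real n"
    using n by (simp add: divide_le_eq mult.commute)
  also have "\<dots> \<le> pi / 4 * c0 * real (Suc n)"
    using c0 by (intro mult_left_mono) auto
  also have "\<dots> = pi / 4 * (\<Sum>k<Suc n. c0)"
    by simp
  also have "\<dots> \<le> pi / 4 * (\<Sum>k<Suc n. c k)"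
    using c_ge by (intro mult_left_mono sum_mono) auto
  finally have "M \<le> pi / 4 * (\<Sum>k<Suc n. c k) - tail_bound"
    by linarith
  then have "\<forall>s\<in>right_half_plane. norm s \<ge> 2 ^ Suc n \<longrightarrow> Re (comb_fun c s) \<ge> M"
    using Re_comb_fun_ge[of _ "Suc n"] by fastforce
  moreover have "(2::real) ^ Suc n > 1"
    by (rule one_less_power) auto
  ultimately show ?thesis
    by blast
qed

abbreviation "comb_image \<equiv> comb_fun c ` right_half_plane"

lemma uminus_mem_comb_image: "w \<in> comb_image \<Longrightarrow> - w \<in> comb_image"
  using comb_fun_inverse inverse_in_right_half_plane by (auto intro!: image_eqI[OF sym])

lemma cnj_mem_comb_image: "w \<in> comb_image \<Longrightarrow> cnj w \<in> comb_image"
proof (elim imageE, rule image_eqI)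
  fix s
  assume s: "s \<in> right_half_plane" "w = comb_fun c s"
  then show "cnj w = comb_fun c (cnj s)" "cnj s \<in> right_half_plane"
    using comb_fun_cnj by (auto simp: right_half_plane_def)
qed

lemma isCont_comb_fun: "s \<in> right_half_plane \<Longrightarrow> isCont (comb_fun c) s"
  using holomorphic_comb_fun open_right_half_plane holomorphic_on_imp_continuous_on continuous_on_eq_continuous_at
  by blast

text \<open>The function is real on the positive axis and takes opposite values at \<open>r\<close>
  and \<open>1 / r\<close>, so the intermediate value theorem applies.\<close>

lemma of_real_mem_comb_image: "of_real t \<in> comb_image"
proof -
  let ?u = "\<lambda>r. Re (comb_fun c (of_real r))"
  have ex: "\<exists>r>1. \<bar>t\<bar> \<le> ?u r"
  proof -
    obtain R where "R > 1" "\<forall>s\<in>right_half_plane. norm s \<ge> R \<longrightarrow> Re (comb_fun c s) \<ge> \<bar>t\<bar>"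
      using Re_comb_fun_large[of "\<bar>t\<bar>"] by blast
    then show ?thesis
      by (intro exI[of _ R]) (auto simp: right_half_plane_def)
  qed
  then obtain r where r: "r > 1" "\<bar>t\<bar> \<le> ?u r"
    by blast
  have "?u (1 / r) = - ?u r"
    using comb_fun_inverse[of c "of_real r"] by simp
  then have "\<exists>x\<ge>1 / r. x \<le> r \<and> ?u x = t"
  proof (intro IVT)
    show "1 / r \<le> r"
      using r mult_mono[of 1 r 1 r] by (simp add: divide_le_eq)
    show "\<forall>x. 1 / r \<le> x \<and> x \<le> r \<longrightarrow> isCont ?u x"
    proof safe
      fix x
      assume "1 / r \<le> x"
      then have "x > 0"
        using r by (smt (verit) divide_pos_pos)
      then have "isCont (comb_fun c) (of_real x)"
        by (intro isCont_comb_fun) (simp add: right_half_plane_def)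
      then have "isCont (\<lambda>x. comb_fun c (of_real x)) x"
        by (rule isCont_o2[rotated]) (intro continuous_intros)
      then show "isCont ?u x"
        by (rule continuous_Re)
    qed
  qed (use r in auto)
  then obtain x where x: "x \<ge> 1 / r" "?u x = t"
    by blast
  then have "x > 0"
    using r by (smt (verit) divide_pos_pos)
  have "Im (comb_fun c (of_real x)) = 0"
    using arctan_sum_of_real[of x] arctan_sum_of_real[of "1 / x"] by (simp add: comb_fun_def)
  then have "of_real t = comb_fun c (of_real x)"
    using x(2) by (simp add: complex_eq_iff)
  then show ?thesis
    using \<open>x > 0\<close> by (auto simp: right_half_plane_def)
qed

section \<open>Boundary values of \<open>comb_fun\<close> and the frontier of its image\<close>

lemma inverse_boundary_limit:
  assumes "Re a = 0" "norm a \<ge> 1"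
  obtains L where "Re L = 0"
    "\<And>s. \<lbrakk>\<And>j. s j \<in> right_half_plane; s \<longlonglongrightarrow> a\<rbrakk> \<Longrightarrow> (\<lambda>j. arctan_sum c (1 / s j)) \<longlonglongrightarrow> L"
proof -
  have "a \<noteq> 0"
    using assms by auto
  have "Re (1 / a) = 0" "norm (1 / a) < 2 ^ Suc 0"
    using assms by (auto simp: Re_divide norm_divide divide_le_eq intro: le_less_trans[of _ 1])
  then obtain L where "Re L = pi / 2 * (\<Sum>k<0. c k)"
    and L: "\<And>s. \<lbrakk>\<And>j. s j \<in> right_half_plane; s \<longlonglongrightarrow> 1 / a\<rbrakk> \<Longrightarrow> (\<lambda>j. arctan_sum c (s j)) \<longlonglongrightarrow> L"
    using boundary_limit[of "1 / a" 0] by blast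
  moreover have "(\<lambda>j. 1 / s j) \<longlonglongrightarrow> 1 / a" if "s \<longlonglongrightarrow> a" for s
    using that \<open>a \<noteq> 0\<close> by (intro tendsto_intros)
  ultimately show ?thesis
    using that[of L] inverse_in_right_half_plane by simp
qed

lemma comb_fun_boundary_limit:
  assumes "Re a = 0" "norm a \<ge> 1" "norm a < 2 ^ Suc n" "\<And>k. k < n \<Longrightarrow> norm a > 2 ^ Suc k"
  obtains L where "Re L = comb_abscissa c (int n)"
    "\<And>s. \<lbrakk>\<And>j. s j \<in> right_half_plane; s \<longlonglongrightarrow> a\<rbrakk> \<Longrightarrow> (\<lambda>j. comb_fun c (s j)) \<longlonglongrightarrow> L"
proof -
  obtain L1 where L1: "Re L1 = pi / 2 * (\<Sum>k<n. c k)"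
    "\<And>s. \<lbrakk>\<And>j. s j \<in> right_half_plane; s \<longlonglongrightarrow> a\<rbrakk> \<Longrightarrow> (\<lambda>j. arctan_sum c (s j)) \<longlonglongrightarrow> L1"
    using boundary_limit[OF assms(1,3,4)] by blast
  obtain L2 where L2: "Re L2 = 0"
    "\<And>s. \<lbrakk>\<And>j. s j \<in> right_half_plane; s \<longlonglongrightarrow> a\<rbrakk> \<Longrightarrow> (\<lambda>j. arctan_sum c (1 / s j)) \<longlonglongrightarrow> L2"
    using inverse_boundary_limit[OF assms(1,2)] by blast
  show ?thesis
  proof (rule that[of "L1 - L2"])
    show "Re (L1 - L2) = comb_abscissa c (int n)"
      by (simp add: L1 L2 comb_abscissa_def)
    show "(\<lambda>j. comb_fun c (s j)) \<longlonglongrightarrow> L1 - L2" if "\<And>j. s j \<in> right_half_plane" "s \<longlonglongrightarrow> a" for s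
      unfolding comb_fun_def using that by (intro tendsto_diff L1 L2)
  qed
qed

text \<open>At a pole the sequence cannot converge, because \<open>arctan_sum c (1 / s)\<close>
  stays convergent there; between poles the limit is the boundary value on one of the lines.\<close>

lemma Re_limit_outer_boundary:
  assumes s: "\<And>j. s j \<in> right_half_plane" "s \<longlonglongrightarrow> a" and a: "Re a = 0" "norm a \<ge> 1"
    and w: "(\<lambda>j. comb_fun c (s j)) \<longlonglongrightarrow> w"
  shows "Re w \<in> range (comb_abscissa c)"
proof (cases "\<exists>m. norm a = 2 ^ Suc m")
  case True
  then obtain m where m: "norm a = 2 ^ Suc m"
    by blast
  obtain L where "(\<lambda>j. arctan_sum c (1 / s j)) \<longlonglongrightarrow> L"
    using inverse_boundary_limit[OF a] s by blast
  then have "(\<lambda>j. comb_fun c (s j) + arctan_sum c (1 / s j)) \<longlonglongrightarrow> w + L"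
    using w by (intro tendsto_add)
  then have "convergent (\<lambda>j. arctan_sum c (s j))"
    by (simp add: comb_fun_def convergentI)
  then show ?thesis
    using divergent_at_pole[OF a(1) m c_pos s] by blast
next
  case False
  define n where "n = (LEAST n. norm a < 2 ^ Suc n)"
  obtain N where "norm a < 2 ^ N"
    using real_arch_pow[of 2 "norm a"] by auto
  then have "norm a < 2 ^ Suc N"
    by (rule less_le_trans) auto
  then have "norm a < 2 ^ Suc n"
    unfolding n_def by (rule LeastI)
  moreover have "norm a > 2 ^ Suc k" if "k < n" for k
    using not_less_Least[of k "\<lambda>n. norm a < 2 ^ Suc n"] that False unfolding n_def by (metis linorder_neqE_linordered_idom)
  ultimately obtain L where L: "Re L = comb_abscissa c (int n)" "(\<lambda>j. comb_fun c (s j)) \<longlonglongrightarrow> L"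
    using comb_fun_boundary_limit[OF a] s by metis
  then have "w = L"
    using LIMSEQ_unique w by blast
  then show ?thesis
    using L by auto
qed

text \<open>Preimages of a sequence tending to \<open>w\<close> stay in a compact half annulus. They
  accumulate at a point of the imaginary axis, as an interior limit would put \<open>w\<close> into
  the open image. A limit of modulus below 1 is reflected by \<open>1 / s\<close>.\<close>

lemma Re_frontier_comb_image:
  assumes "w \<in> frontier comb_image"
  shows "Re w \<in> range (comb_abscissa c)"
proof -
  have "open comb_image"
    using open_mapping_thm3[OF holomorphic_comb_fun open_right_half_plane inj_on_comb_fun] .
  then have w: "w \<in> closure comb_image" "w \<notin> comb_image"
    using assms by (auto simp: frontier_def interior_open)
  obtain v where v: "\<And>j. v j \<in> comb_image" "v \<longlonglongrightarrow> w"
    using w(1) closure_sequential by blast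
  then obtain s where s: "\<And>j. s j \<in> right_half_plane" "\<And>j. v j = comb_fun c (s j)"
    unfolding image_iff by metis
  then have "v = (\<lambda>j. comb_fun c (s j))"
    by blast
  then have lim: "(\<lambda>j. comb_fun c (s j)) \<longlonglongrightarrow> w"
    using v by simp
  obtain R where R: "R > 1" "\<And>s. \<lbrakk>s \<in> right_half_plane; norm s \<ge> R\<rbrakk> \<Longrightarrow> Re (comb_fun c s) \<ge> \<bar>Re w\<bar> + 1"
    using Re_comb_fun_large by blast
  have "eventually (\<lambda>j. norm (comb_fun c (s j) - w) < 1) sequentially"
    using lim by (simp add: tendsto_iff dist_norm)
  then obtain J where J: "\<And>j. j \<ge> J \<Longrightarrow> norm (comb_fun c (s j) - w) < 1"
    by (auto simp: eventually_sequentially)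
  have bounds: "norm (s j) \<le> R \<and> 1 / R \<le> norm (s j)" if "j \<ge> J" for j
  proof -
    have Re_bound: "\<bar>Re (comb_fun c (s j))\<bar> < \<bar>Re w\<bar> + 1"
      using J[OF that] abs_Re_le_cmod[of "comb_fun c (s j) - w"] by simp
    have "s j \<noteq> 0"
      using s(1)[of j] by (auto simp: right_half_plane_def)
    have "norm (s j) < R"
      using R(2)[OF s(1), of j] Re_bound by linarith
    moreover have "norm (1 / s j) < R"
      using R(2)[OF inverse_in_right_half_plane[OF s(1)], of j] Re_bound comb_fun_inverse[of c "s j"]
      by (smt (verit) uminus_complex.simps(1))
    ultimately show ?thesis
      using R(1) \<open>s j \<noteq> 0\<close> by (simp add: norm_divide field_simps)
  qed
  define K where "K = {z. Re z \<ge> 0} \<inter> {z. 1 / R \<le> norm z} \<inter> cball 0 R"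
  have "compact K"
    unfolding K_def by (intro closed_Int_compact closed_Int closed_halfspace_Re_ge closed_Collect_le continuous_intros) auto
  moreover have "\<forall>j. s (j + J) \<in> K"
    using bounds s(1) by (auto simp: K_def right_half_plane_def less_imp_le)
  ultimately obtain a r where a: "a \<in> K" "strict_mono r" "((\<lambda>j. s (j + J)) \<circ> r) \<longlonglongrightarrow> a"
    unfolding compact_def by meson
  define t where "t = (\<lambda>j. s (r j + J))"
  have t: "\<And>j. t j \<in> right_half_plane" "t \<longlonglongrightarrow> a"
    using s a by (auto simp: t_def o_def)
  have limt: "(\<lambda>j. comb_fun c (t j)) \<longlonglongrightarrow> w"
    using LIMSEQ_subseq_LIMSEQ[OF LIMSEQ_ignore_initial_segment[OF lim, of J] a(2)] by (simp add: t_def o_def)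
  have "a \<notin> right_half_plane"
  proof
    assume mem: "a \<in> right_half_plane"
    then have "(\<lambda>j. comb_fun c (t j)) \<longlonglongrightarrow> comb_fun c a"
      by (intro isCont_tendsto_compose[OF isCont_comb_fun] t)
    then show False
      using LIMSEQ_unique[OF limt] w(2) mem by blast
  qed
  then have "Re a = 0"
    using a(1) by (auto simp: K_def right_half_plane_def)
  have "a \<noteq> 0"
    using a(1) R(1) by (auto simp: K_def)
  show ?thesis
  proof (cases "norm a \<ge> 1")
    case True
    then show ?thesis
      using Re_limit_outer_boundary[OF t \<open>Re a = 0\<close> _ limt] by blast
  next
    case False
    have "Re (- w) \<in> range (comb_abscissa c)"
    proof (rule Re_limit_outer_boundary)
      show "1 / t j \<in> right_half_plane" for j
        by (rule inverse_in_right_half_plane[OF t(1)])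
      show "(\<lambda>j. 1 / t j) \<longlonglongrightarrow> 1 / a"
        using t(2) \<open>a \<noteq> 0\<close> by (intro tendsto_intros)
      show "(\<lambda>j. comb_fun c (1 / t j)) \<longlonglongrightarrow> - w"
        unfolding comb_fun_inverse by (intro tendsto_minus limt)
      show "Re (1 / a) = 0"
        using \<open>Re a = 0\<close> by (simp add: Re_divide)
      show "1 \<le> norm (1 / a)"
        using False \<open>a \<noteq> 0\<close> by (simp add: norm_divide)
    qed
    then obtain n where "Re (- w) = comb_abscissa c n"
      by blast
    then have "Re w = comb_abscissa c (- n)"
      by (simp add: comb_abscissa_uminus)
    then show ?thesis
      by blast
  qed
qed

text \<open>The vertical line through \<open>w\<close> meets the image on the real axis; were
  \<open>w\<close> missing, the line would meet the frontier, which lies over the abscissae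
  only.\<close>

lemma mem_comb_image_off_lines:
  assumes "Re w \<notin> range (comb_abscissa c)"
  shows "w \<in> comb_image"
proof (rule ccontr)
  assume w: "w \<notin> comb_image"
  let ?l = "{z. Re z = Re w}"
  have "connected ?l"
    by (rule convex_connected) (auto simp: convex_def simp flip: distrib_right)
  moreover have "of_real (Re w) \<in> ?l \<inter> comb_image" "w \<in> ?l - comb_image"
    using w of_real_mem_comb_image by auto
  ultimately have "?l \<inter> frontier comb_image \<noteq> {}"
    by (intro connected_Int_frontier) blast+
  then obtain z where "Re z = Re w" "z \<in> frontier comb_image"
    by blast
  then show False
    using assms Re_frontier_comb_image[of z] by simp
qed

text \<open>Every abscissa really carries a slit: a boundary value on that line is not in the image,
  for otherwise the continuous inverse would send it to the boundary point \<open>a\<close>.\<close>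

lemma exists_not_mem_comb_image:
  "\<exists>y. Complex (comb_abscissa c n) y \<notin> comb_image"
proof -
  have nat_case: "\<exists>y. Complex (comb_abscissa c (int n)) y \<notin> comb_image" for n
  proof -
    \<comment> \<open>The factor 3/2 places \<open>a\<close> strictly between the radii
      \<open>2 ^ n\<close> and \<open>2 ^ Suc n\<close>.\<close>
    define a :: complex where "a = \<i> * of_real (2 ^ n * (3 / 2))"
    define s :: "nat \<Rightarrow> complex" where "s = (\<lambda>j. a + of_real (inverse (real (Suc j))))"
    have Re_a: "Re a = 0"
      by (simp add: a_def)
    have na: "norm a = 2 ^ n * (3 / 2)"
      by (simp add: a_def norm_mult norm_power)
    have s: "s j \<in> right_half_plane" for j
      by (simp add: s_def right_half_plane_def a_def)
    have "(\<lambda>j. a + of_real (inverse (real (Suc j)))) \<longlonglongrightarrow> a + of_real 0"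
      by (intro tendsto_add tendsto_const tendsto_of_real LIMSEQ_inverse_real_of_nat)
    then have lim: "s \<longlonglongrightarrow> a"
      by (simp add: s_def)
    have "norm a \<ge> 1"
      using one_le_power[of "2::real" n] unfolding na by linarith
    moreover have "norm a < 2 ^ Suc n"
      unfolding na by simp
    moreover have "norm a > 2 ^ Suc k" if "k < n" for k
    proof -
      have "(2::real) ^ Suc k \<le> 2 ^ n"
        using that by (intro power_increasing) auto
      also have "\<dots> < norm a"
        unfolding na by simp
      finally show ?thesis .
    qed
    ultimately obtain L where L: "Re L = comb_abscissa c (int n)" "(\<lambda>j. comb_fun c (s j)) \<longlonglongrightarrow> L"
      using comb_fun_boundary_limit[OF Re_a, of n] s lim by metis
    have "L \<notin> comb_image"
    proof
      assume mem: "L \<in> comb_image"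
      obtain g where g: "g holomorphic_on comb_image" "\<And>z. z \<in> right_half_plane \<Longrightarrow> g (comb_fun c z) = z"
        using holomorphic_has_inverse[OF holomorphic_comb_fun open_right_half_plane inj_on_comb_fun] by metis
      have "open comb_image"
        using open_mapping_thm3[OF holomorphic_comb_fun open_right_half_plane inj_on_comb_fun] .
      then have "isCont g L"
        using g(1) mem holomorphic_on_imp_continuous_on continuous_on_eq_continuous_at by blast
      then have "(\<lambda>j. g (comb_fun c (s j))) \<longlonglongrightarrow> g L"
        using L(2) by (rule isCont_tendsto_compose)
      then have "g L = a"
        using lim LIMSEQ_unique by (simp add: g(2)[OF s])
      then have "a \<in> right_half_plane"
        using mem g(2) by auto
      then show False
        by (simp add: a_def right_half_plane_def)
    qed
    then show ?thesis
      using L(1) complex_surj[of L] by metis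
  qed
  show ?thesis
  proof (cases "n \<ge> 0")
    case True
    then show ?thesis
      using nat_case[of "nat n"] by simp
  next
    case False
    then obtain y where y: "Complex (comb_abscissa c (- n)) y \<notin> comb_image"
      using nat_case[of "nat (- n)"] by auto
    have "- Complex (comb_abscissa c n) (- y) = Complex (comb_abscissa c (- n)) y"
      by (simp add: comb_abscissa_uminus complex_eq_iff)
    then show ?thesis
      using y uminus_mem_comb_image by metis
  qed
qed

section \<open>Identification of the image as a comb domain\<close>

lemma riemann_map_comb_image: "riemann_map (comb_fun c \<circ> cayley) comb_image"
  unfolding riemann_map_def
proof (intro conjI)
  show "(comb_fun c \<circ> cayley) holomorphic_on ball 0 1"
    by (rule holomorphic_on_compose[OF holomorphic_cayley]) (simp add: cayley_image holomorphic_comb_fun)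
  show "inj_on (comb_fun c \<circ> cayley) (ball 0 1)"
    by (rule comp_inj_on[OF inj_on_cayley]) (simp add: cayley_image inj_on_comb_fun)
  show "(comb_fun c \<circ> cayley) ` ball 0 1 = comb_image"
    by (simp only: image_comp[symmetric] cayley_image)
qed

text \<open>The Riemann mapping theorem is read backwards: a conformal image of the disc is open and
  simply connected.\<close>

lemma open_simply_connected_comb_image: "open comb_image \<and> simply_connected comb_image"
proof -
  let ?f = "comb_fun c \<circ> cayley"
  have f: "?f holomorphic_on ball 0 1" "inj_on ?f (ball 0 1)" "?f ` ball 0 1 = comb_image"
    using riemann_map_comb_image by (auto simp: riemann_map_def)
  obtain g where "g holomorphic_on ?f ` ball 0 1" "\<And>z. z \<in> ball 0 1 \<Longrightarrow> g (?f z) = z"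
    using holomorphic_has_inverse[OF f(1) open_ball f(2)] by metis
  then have "g holomorphic_on comb_image \<and> ?f holomorphic_on ball 0 1 \<and>
      (\<forall>z\<in>comb_image. g z \<in> ball 0 1 \<and> ?f (g z) = z) \<and> (\<forall>z\<in>ball 0 1. ?f z \<in> comb_image \<and> g (?f z) = z)"
    using f by (metis (no_types, lifting) image_iff)
  then show ?thesis
    using Riemann_mapping_theorem[of comb_image] by blast
qed

text \<open>As \<open>comb_image\<close> is simply connected, each component of its complement is unbounded; it lies on one of
  the vertical lines and avoids the real axis.\<close>

lemma not_mem_comb_image_above:
  assumes p: "Complex (comb_abscissa c n) y \<notin> comb_image" and y: "0 < y" "y \<le> y'"
  shows "Complex (comb_abscissa c n) y' \<notin> comb_image"
proof -
  let ?p = "Complex (comb_abscissa c n) y"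
  define K where "K = connected_component_set (- comb_image) ?p"
  have K: "connected K" "K \<subseteq> - comb_image" "?p \<in> K"
    using p by (auto simp: K_def connected_component_subset)
  have "K \<in> components (- comb_image)"
    unfolding K_def using p by (auto simp: components_def)
  then have unb: "\<not> bounded K"
    using open_simply_connected_comb_image simply_connected_eq_unbounded_complement_components by blast
  have range: "Re z \<in> range (comb_abscissa c)" if "z \<in> K" for z
    using that K(2) mem_comb_image_off_lines by blast
  have conn_Re: "connected (Re ` K)" and conn_Im: "connected (Im ` K)"
    using K(1) by (auto intro!: connected_continuous_image continuous_intros)
  \<comment> \<open>The real parts form a connected set inside the countable set of abscissae, hence
    a single point.\<close>
  have Re: "Re z = comb_abscissa c n" if z: "z \<in> K" for z
  proof (rule ccontr)
    assume ne: "Re z \<noteq> comb_abscissa c n"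
    define l u where "l = min (Re z) (comb_abscissa c n)" and "u = max (Re z) (comb_abscissa c n)"
    have "l < u" "l \<in> Re ` K" "u \<in> Re ` K"
      using ne z K(3) by (auto simp: l_def u_def min_def max_def intro: rev_image_eqI)
    then have "{l..u} \<subseteq> range (comb_abscissa c)"
      using connected_contains_Icc[OF conn_Re] range by blast
    then have "countable {l..u}"
      by (rule countable_subset) simp
    then show False
      using uncountable_closed_interval[of l u] \<open>l < u\<close> by blast
  qed
  have zero: "0 \<notin> Im ` K"
  proof
    assume "0 \<in> Im ` K"
    then obtain z where z: "z \<in> K" "Im z = 0"
      by auto
    then have "z = of_real (Re z)"
      by (simp add: complex_eq_iff)
    then show False
      using z K(2) of_real_mem_comb_image by (metis ComplD subsetD)
  qed
  have pos: "Im z > 0" if "z \<in> K" for z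
  proof (rule ccontr)
    assume "\<not> Im z > 0"
    then have "0 \<in> {Im z..Im ?p}"
      using y by auto
    also have "\<dots> \<subseteq> Im ` K"
      using that K(3) by (intro connected_contains_Icc[OF conn_Im] imageI)
    finally show False
      using zero by blast
  qed
  \<comment> \<open>The real part is constant on \<open>K\<close>, so only the positive imaginary
    part can be unbounded.\<close>
  obtain z where z: "z \<in> K" "Im z > y'"
  proof -
    have "\<exists>z\<in>K. norm z > \<bar>comb_abscissa c n\<bar> + y'"
      using unb unfolding bounded_iff by (meson not_le)
    then obtain z where z: "z \<in> K" "norm z > \<bar>comb_abscissa c n\<bar> + y'"
      by blast
    then have "Im z > y'"
      using cmod_le[of z] Re[OF z(1)] pos[OF z(1)] by linarith
    then show ?thesis
      using that z by blast
  qed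
  have "y' \<in> {Im ?p..Im z}"
    using y z by auto
  also have "\<dots> \<subseteq> Im ` K"
    using z K(3) by (intro connected_contains_Icc[OF conn_Im] imageI)
  finally obtain z' where "z' \<in> K" "y' = Im z'"
    by blast
  then show ?thesis
    using Re K(2) complex_surj[of z'] by (metis ComplD subsetD)
qed

lemma is_comb_domain_comb_image: "is_comb_domain comb_image"
proof -
  let ?P = "\<lambda>n y. 0 \<le> y \<and> Complex (comb_abscissa c n) y \<notin> comb_image"
  have abs_iff: "Complex x y \<in> comb_image \<longleftrightarrow> Complex x \<bar>y\<bar> \<in> comb_image" for x y
    using cnj_mem_comb_image[of "Complex x y"] cnj_mem_comb_image[of "Complex x (- y)"]
    by (cases "y \<ge> 0") (auto simp: complex_cnj)
  \<comment> \<open>The height of the slit is the lowest missing point in the upper half; closedness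
    of the complement makes the infimum attained.\<close>
  define b where "b = (\<lambda>n. Inf {y. ?P n y})"
  have b: "?P n (b n)" "\<And>y. ?P n y \<Longrightarrow> b n \<le> y" for n
  proof -
    have "{y. ?P n y} \<noteq> {}"
      using exists_not_mem_comb_image[of n] abs_iff by (metis (mono_tags) abs_ge_zero empty_iff mem_Collect_eq)
    moreover have bdd: "bdd_below {y. ?P n y}"
      by (auto intro: bdd_belowI[of _ 0])
    moreover have "closed {y. ?P n y}"
    proof -
      have "closed ((\<lambda>y. Complex (comb_abscissa c n) y) -` (- comb_image) \<inter> {0..})"
        using open_simply_connected_comb_image
        by (intro closed_Int closed_vimage closed_Compl) (auto intro!: continuous_intros simp: Complex_eq)
      moreover have "(\<lambda>y. Complex (comb_abscissa c n) y) -` (- comb_image) \<inter> {0..} = {y. ?P n y}"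
        by auto
      ultimately show ?thesis
        by simp
    qed
    ultimately have "b n \<in> {y. ?P n y}"
      unfolding b_def by (rule closed_contains_Inf)
    then show "?P n (b n)"
      by blast
    show "b n \<le> y" if "?P n y" for y
      unfolding b_def using that bdd by (intro cInf_lower) auto
  qed
  have b_pos: "b n > 0" for n
  proof -
    have "b n \<noteq> 0"
      using b(1)[of n] of_real_mem_comb_image[of "comb_abscissa c n"] by (auto simp: complex_of_real_def)
    then show ?thesis
      using b(1)[of n] by simp
  qed
  have mem: "Complex (comb_abscissa c n) y \<in> comb_image \<longleftrightarrow> \<bar>y\<bar> < b n" for n y
  proof
    show "\<bar>y\<bar> < b n" if "Complex (comb_abscissa c n) y \<in> comb_image"
    proof (rule ccontr)
      assume "\<not> \<bar>y\<bar> < b n"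
      then have "Complex (comb_abscissa c n) \<bar>y\<bar> \<notin> comb_image"
        using not_mem_comb_image_above[of n "b n" "\<bar>y\<bar>"] b(1)[of n] b_pos[of n] by simp
      then show False
        using that abs_iff by blast
    qed
    show "Complex (comb_abscissa c n) y \<in> comb_image" if "\<bar>y\<bar> < b n"
      using that b(2)[of "\<bar>y\<bar>" n] abs_iff by force
  qed
  have "comb_image = comb_domain (comb_abscissa c) b"
  proof (rule set_eqI)
    fix w
    show "w \<in> comb_image \<longleftrightarrow> w \<in> comb_domain (comb_abscissa c) b"
    proof (cases "Re w \<in> range (comb_abscissa c)")
      case True
      then obtain n where n: "Re w = comb_abscissa c n"
        by blast
      then have "w = Complex (comb_abscissa c n) (Im w)"
        by (simp add: complex_eq_iff)
      then have "w \<in> comb_image \<longleftrightarrow> \<bar>Im w\<bar> < b n"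
        using mem by metis
      moreover have "comb_abscissa c n = comb_abscissa c m \<longleftrightarrow> n = m" for m
        using strict_mono_eq[OF strict_mono_comb_abscissa] .
      ultimately show ?thesis
        by (simp add: mem_comb_domain n)
    next
      case False
      then show ?thesis
        using mem_comb_image_off_lines[OF False] by (auto simp: mem_comb_domain)
    qed
  qed
  moreover have "comb_abscissa c 0 = 0"
    by (simp add: comb_abscissa_def)
  moreover have "pi / 2 * c0 > 0"
    using c0 by simp
  ultimately show ?thesis
    unfolding is_comb_domain_def using strict_mono_comb_abscissa comb_abscissa_gap b_pos by blast
qed

end

section \<open>Hardy numbers of the explicit combs\<close>

lemma cos_shift_nonzero:
  assumes "cos x = 0" "0 < \<epsilon>" "\<epsilon> < pi"
  shows "cos (x + \<epsilon>) \<noteq> 0"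
proof -
  have "sin x \<noteq> 0" "sin \<epsilon> \<noteq> 0"
    using sin_cos_squared_add[of x] assms sin_gt_zero[of \<epsilon>] by auto
  then show ?thesis
    using assms by (simp add: cos_add)
qed

text \<open>The mechanism behind M. Riesz' theorem on conjugate functions: unless \<open>q\<close> is an odd integer,
  \<open>\<kappa> cos (q \<theta>)\<close> is at least \<open>1\<close> near \<open>\<theta> = \<plusminus>\<pi>/2\<close> for a suitable constant \<open>\<kappa>\<close>, and away from there
  the modulus is controlled by the real part.\<close>

lemma norm_powr_le_Re_powr:
  assumes q: "q > 0" and nz: "cos (q * (pi / 2)) \<noteq> 0"
  shows "\<exists>K \<kappa>. K \<ge> 0 \<and> (\<forall>v. Re v > 0 \<longrightarrow> norm v powr q \<le> K * Re v powr q + \<kappa> * Re (v powr of_real q))"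
proof -
  \<comment> \<open>Normalised so that \<open>\<kappa> * cos (q * \<theta>)\<close> equals 2 at
    \<open>pi / 2\<close> and exceeds 1 nearby.\<close>
  define \<kappa> where "\<kappa> = 2 / cos (q * (pi / 2))"
  have lim: "((\<lambda>\<theta>. \<kappa> * cos (q * \<theta>)) \<longlongrightarrow> \<kappa> * cos (q * (pi / 2))) (at (pi / 2))"
    by (intro tendsto_intros)
  have "\<kappa> * cos (q * (pi / 2)) = 2"
    using nz by (simp add: \<kappa>_def)
  then have "eventually (\<lambda>\<theta>. \<kappa> * cos (q * \<theta>) > 1) (at (pi / 2))"
    using order_tendstoD(1)[OF lim, of 1] by simp
  then obtain d where d: "d > 0" "\<And>\<theta>. \<lbrakk>\<theta> \<noteq> pi / 2; \<bar>\<theta> - pi / 2\<bar> < d\<rbrakk> \<Longrightarrow> \<kappa> * cos (q * \<theta>) > 1"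
    unfolding eventually_at by (auto simp: dist_real_def)
  define e where "e = min d (pi / 2)"
  have e: "0 < e" "e \<le> d" "e \<le> pi / 2"
    using d(1) by (auto simp: e_def)
  define s where "s = sin e"
  have s: "s > 0"
    unfolding s_def using e pi_gt_zero by (intro sin_gt_zero) linarith+
  \<comment> \<open>Away from the imaginary axis, \<open>K * Re v powr q\<close> is at least
    \<open>1 + \<bar>\<kappa>\<bar>\<close> times \<open>norm v powr q\<close>, which also absorbs a
    negative \<open>\<kappa>\<close> term.\<close>
  define K where "K = (1 + \<bar>\<kappa>\<bar>) / s powr q"
  have "K \<ge> 0"
    by (simp add: K_def)
  moreover have "norm v powr q \<le> K * Re v powr q + \<kappa> * Re (v powr of_real q)" if v: "Re v > 0" for v
  proof -
    define \<theta> where "\<theta> = \<bar>Arg v\<bar>"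
    have "v \<noteq> 0"
      using v by auto
    have \<theta>: "0 \<le> \<theta>" "\<theta> < pi / 2"
      using Arg_Re_pos[of v] v by (auto simp: \<theta>_def)
    have "cos (q * Arg v) = cos (q * \<theta>)"
      unfolding \<theta>_def by (cases "Arg v \<ge> 0") auto
    then have Re_powr: "Re (v powr of_real q) = norm v powr q * cos (q * \<theta>)"
      using Re_powr_of_real[OF \<open>v \<noteq> 0\<close>] by simp
    have Re_v: "Re v = norm v * cos \<theta>"
      using arg_cong[OF rcis_cmod_Arg[of v], of Re] by (simp add: \<theta>_def)
    show ?thesis
    proof (cases "\<theta> > pi / 2 - e")
      case True
      then have "\<kappa> * cos (q * \<theta>) > 1"
        using \<theta> e by (intro d(2)) auto
      then have "norm v powr q * 1 \<le> norm v powr q * (\<kappa> * cos (q * \<theta>))"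
        by (intro mult_left_mono) auto
      also have "\<dots> = \<kappa> * Re (v powr of_real q)"
        by (simp add: Re_powr)
      finally show ?thesis
        using \<open>K \<ge> 0\<close> by (smt (verit) mult_nonneg_nonneg mult.right_neutral powr_ge_zero)
    next
      case False
      have "cos (pi / 2 - e) \<le> cos \<theta>"
        using False \<theta> e by (intro cos_monotone_0_pi_le) auto
      then have "norm v * s \<le> Re v"
        unfolding Re_v s_def by (intro mult_left_mono) (simp_all add: cos_diff)
      then have "norm v powr q * s powr q \<le> Re v powr q"
        using q s powr_mono2[of q "norm v * s" "Re v"] by (simp add: powr_mult)
      then have "K * (norm v powr q * s powr q) \<le> K * Re v powr q"
        using \<open>K \<ge> 0\<close> by (intro mult_left_mono)
      moreover have "K * (norm v powr q * s powr q) = (1 + \<bar>\<kappa>\<bar>) * norm v powr q"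
        using s by (simp add: K_def)
      moreover have "- (\<bar>\<kappa>\<bar> * norm v powr q) \<le> \<kappa> * Re (v powr of_real q)"
      proof -
        have "\<bar>\<kappa> * Re (v powr of_real q)\<bar> \<le> \<bar>\<kappa>\<bar> * norm v powr q"
          unfolding Re_powr abs_mult by (intro mult_left_mono) (auto intro!: mult_left_le)
        then show ?thesis
          by linarith
      qed
      ultimately show ?thesis
        by (simp add: distrib_right)
    qed
  qed
  ultimately show ?thesis
    by blast
qed

abbreviation geometric :: "real \<Rightarrow> nat \<Rightarrow> real" where
  "geometric a \<equiv> (\<lambda>k. 2 powr (a * real k))"

lemma geometric_eq_power: "geometric a k = (2 powr a) ^ k"
  by (simp add: powr_powr flip: powr_realpow)

lemma arctan_series_geometric:
  assumes "a < 1"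
  shows "arctan_series (geometric a)"
proof
  have "2 powr a < 2 powr 1"
    using assms by (intro powr_less_mono) auto
  then have "summable (\<lambda>k. (2 powr a / 2) ^ k)"
    by (intro summable_geometric) simp
  then show "summable (\<lambda>k. geometric a k / 2 ^ k)"
    by (simp only: geometric_eq_power power_divide)
qed auto

section \<open>Harmonic majorants for geometric coefficients\<close>

text \<open>For \<open>u\<close> in \<open>{0<..<pi / 2}\<close>, \<open>u powr q\<close> is at most
  \<open>(pi / 2) powr (q - 1) * u\<close>, so a single term of the right-hand series controls the
  \<open>q\<close>-th power of a term on the left. The surplus \<open>\<eta>\<close> leaves a factor
  \<open>2 powr (- \<eta> * k)\<close>, which sums to \<open>W\<close>.\<close>

lemma Re_arctan_sum_geometric_powr_le:
  assumes "a < 1" "\<eta> > 0" "q \<ge> 1" "(a + \<eta>) * q < 1"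
  shows "\<exists>K\<ge>0. \<forall>s\<in>right_half_plane.
    Re (arctan_sum (geometric a) s) powr q \<le> K * Re (arctan_sum (geometric ((a + \<eta>) * q)) s)"
proof -
  interpret a: arctan_series "geometric a"
    by (rule arctan_series_geometric) fact
  interpret b: arctan_series "geometric ((a + \<eta>) * q)"
    by (rule arctan_series_geometric) fact
  define W where "W = (\<Sum>k. geometric (- \<eta>) k)"
  have W_sum: "summable (geometric (- \<eta>))"
  proof -
    have "2 powr (- \<eta>) < 2 powr 0"
      using assms by (intro powr_less_mono) auto
    then have "summable (\<lambda>k. (2 powr (- \<eta>)) ^ k)"
      by (intro summable_geometric) simp
    then show ?thesis
      by (simp only: geometric_eq_power)
  qed
  have "W \<ge> 0"
    unfolding W_def by (intro suminf_nonneg W_sum) auto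
  define P where "P = (pi / 2) powr (q - 1)"
  have "P \<ge> 0"
    by (simp add: P_def)
  have "Re (arctan_sum (geometric a) s) powr q \<le> W powr q * P * Re (arctan_sum (geometric ((a + \<eta>) * q)) s)"
    if s: "s \<in> right_half_plane" for s
  proof -
    define u where "u = (\<lambda>k. Re (Arctan (s / 2 ^ Suc k)))"
    have u: "0 < u k" "u k < pi / 2" for k
      using divide_pow2_in_right_half_plane[OF s, of "Suc k"] Re_Arctan_pos[of "s / 2 ^ Suc k"]
        Re_Arctan_less[of "s / 2 ^ Suc k"]
      by (auto simp: u_def right_half_plane_def)
    define M where "M = Re (arctan_sum (geometric ((a + \<eta>) * q)) s)"
    have M: "M = (\<Sum>k. geometric ((a + \<eta>) * q) k * u k)"
      "summable (\<lambda>k. geometric ((a + \<eta>) * q) k * u k)"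
      unfolding M_def u_def using b.Re_arctan_sum b.Re_summable by auto
    have M_nonneg: "M \<ge> 0"
      unfolding M(1) using u(1) by (intro suminf_nonneg M(2)) (simp add: less_imp_le)
    define Z where "Z = (P * M) powr (1 / q)"
    have le: "geometric a k * u k \<le> geometric (- \<eta>) k * Z" for k
    proof -
      have "u k powr q = u k powr (1 + (q - 1))"
        by simp
      also have "\<dots> = u k * u k powr (q - 1)"
        using u(1)[of k] by (simp only: powr_add powr_one less_imp_le)
      also have "\<dots> \<le> u k * P"
        unfolding P_def using u[of k] assms(3) by (intro mult_mono powr_mono2) auto
      finally have "geometric ((a + \<eta>) * q) k * u k powr q \<le> P * (geometric ((a + \<eta>) * q) k * u k)"
        by (simp add: algebra_simps)
      also have "geometric ((a + \<eta>) * q) k * u k \<le> M"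
        using sum_le_suminf[OF M(2), of "{k}"] u(1) by (simp add: M(1) less_imp_le)
      finally have "geometric ((a + \<eta>) * q) k * u k powr q \<le> P * M"
        using \<open>P \<ge> 0\<close> by (simp add: mult_left_mono)
      moreover have "geometric ((a + \<eta>) * q) k * u k powr q = (geometric (a + \<eta>) k * u k) powr q"
        using u(1)[of k] by (simp add: powr_mult powr_powr algebra_simps)
      ultimately have "((geometric (a + \<eta>) k * u k) powr q) powr (1 / q) \<le> Z"
        unfolding Z_def using assms(3) by (intro powr_mono2) auto
      then have "geometric (a + \<eta>) k * u k \<le> Z"
        using assms(3) u(1)[of k] by (simp add: powr_powr)
      then have "geometric (- \<eta>) k * (geometric (a + \<eta>) k * u k) \<le> geometric (- \<eta>) k * Z"
        by (intro mult_left_mono) auto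
      moreover have "geometric (- \<eta>) k * geometric (a + \<eta>) k = geometric a k"
        by (simp add: algebra_simps flip: powr_add)
      ultimately show ?thesis
        by (simp only: mult.assoc[symmetric])
    qed
    have "Re (arctan_sum (geometric a) s) = (\<Sum>k. geometric a k * u k)"
      by (simp only: a.Re_arctan_sum u_def)
    also have "\<dots> \<le> (\<Sum>k. geometric (- \<eta>) k * Z)"
      using a.Re_summable[of s] by (intro suminf_le le summable_mult2 W_sum) (simp only: u_def)
    also have "\<dots> = W * Z"
      unfolding W_def by (rule suminf_mult2[OF W_sum, symmetric])
    finally have "Re (arctan_sum (geometric a) s) powr q \<le> (W * Z) powr q"
      using assms(3) suminf_nonneg[OF a.Re_summable a.Re_arctan_term_nonneg[OF s]]
      by (intro powr_mono2) (simp_all only: a.Re_arctan_sum)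
    also have "\<dots> = W powr q * P * M"
      using \<open>W \<ge> 0\<close> \<open>P \<ge> 0\<close> M_nonneg assms(3) by (simp add: powr_mult Z_def powr_powr)
    finally show ?thesis
      by (simp only: M_def)
  qed
  then show ?thesis
    using \<open>P \<ge> 0\<close> by (intro exI[of _ "W powr q * P"]) simp
qed

lemma geometric_majorant:
  assumes "a < 1" "q \<ge> 1" "a * q < 1" "cos (q * (pi / 2)) \<noteq> 0"
  shows "\<exists>H. H holomorphic_on right_half_plane \<and>
    (\<forall>s\<in>right_half_plane. norm (arctan_sum (geometric a) s) powr q \<le> Re (H s))"
proof -
  \<comment> \<open>Half of the available slack: \<open>(a + \<eta>) * q\<close> is the midpoint of
    \<open>a * q\<close> and 1.\<close>
  define \<eta> where "\<eta> = (1 - a * q) / (2 * q)"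
  have \<eta>: "\<eta> > 0" "(a + \<eta>) * q < 1"
    using assms by (auto simp: \<eta>_def field_simps)
  interpret a: arctan_series "geometric a"
    by (rule arctan_series_geometric) fact
  interpret b: arctan_series "geometric ((a + \<eta>) * q)"
    by (rule arctan_series_geometric) fact
  obtain K \<kappa> where K: "K \<ge> 0"
    "\<And>v. Re v > 0 \<Longrightarrow> norm v powr q \<le> K * Re v powr q + \<kappa> * Re (v powr of_real q)"
    using norm_powr_le_Re_powr[of q] assms by auto
  obtain K' where K': "K' \<ge> 0" "\<And>s. s \<in> right_half_plane \<Longrightarrow>
      Re (arctan_sum (geometric a) s) powr q \<le> K' * Re (arctan_sum (geometric ((a + \<eta>) * q)) s)"
    using Re_arctan_sum_geometric_powr_le[OF assms(1) \<eta>(1) assms(2) \<eta>(2)] by blast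
  \<comment> \<open>The first summand dominates the power of the real part; the second is
    holomorphic because the base has positive real part.\<close>
  define H where "H = (\<lambda>s. of_real (K * K') * arctan_sum (geometric ((a + \<eta>) * q)) s
     + of_real \<kappa> * arctan_sum (geometric a) s powr of_real q)"
  have pos: "Re (arctan_sum (geometric a) s) > 0" if s: "s \<in> right_half_plane" for s
    unfolding a.Re_arctan_sum
    using divide_pow2_in_right_half_plane[OF s] Re_Arctan_pos
    by (intro suminf_pos a.Re_summable) (simp add: right_half_plane_def del: power_Suc)
  have "H holomorphic_on right_half_plane"
    unfolding H_def
    using pos by (intro holomorphic_intros a.holomorphic_half_plane b.holomorphic_half_plane)
      (force simp: complex_nonpos_Reals_iff)
  moreover have "norm (arctan_sum (geometric a) s) powr q \<le> Re (H s)" if s: "s \<in> right_half_plane" for s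
  proof -
    have "K * Re (arctan_sum (geometric a) s) powr q \<le> K * (K' * Re (arctan_sum (geometric ((a + \<eta>) * q)) s))"
      using K(1) K'(2)[OF s] by (rule mult_left_mono[rotated])
    then show ?thesis
      using K(2)[OF pos[OF s]] by (simp add: H_def)
  qed
  ultimately show ?thesis
    by blast
qed

section \<open>Hardy membership for an arbitrary Riemann map of the image\<close>

context comb_map
begin

text \<open>The majorant is composed with the inverse of \<open>comb_fun c\<close> and with
  \<open>f\<close>, so it serves any Riemann map, in particular the one chosen by
  \<open>SOME\<close>.\<close>

lemma in_hardy_transfer:
  fixes f H :: "complex \<Rightarrow> complex"
  assumes f: "riemann_map f comb_image" and p: "p > 0" and H: "H holomorphic_on right_half_plane"
    and le: "\<And>s. s \<in> right_half_plane \<Longrightarrow> norm (comb_fun c s) powr p \<le> Re (H s)"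
  shows "in_hardy p f"
proof -
  obtain g where g: "g holomorphic_on comb_image" "\<And>s. s \<in> right_half_plane \<Longrightarrow> g (comb_fun c s) = s"
    using holomorphic_has_inverse[OF holomorphic_comb_fun open_right_half_plane inj_on_comb_fun] by metis
  have fhol: "f holomorphic_on ball 0 1" and fim: "f ` ball 0 1 = comb_image"
    using f by (auto simp: riemann_map_def)
  show ?thesis
  proof (rule in_hardy_harmonic_majorant[OF p fhol])
    have "(\<lambda>z. g (f z)) holomorphic_on ball 0 1"
      using holomorphic_on_compose_gen[of f "ball 0 1" g comb_image] fhol g(1) fim by (simp add: o_def)
    moreover have "(\<lambda>z. g (f z)) ` ball 0 1 \<subseteq> right_half_plane"
    proof clarify
      fix z :: complex
      assume "z \<in> ball 0 1"
      then have "f z \<in> comb_image"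
        using fim by blast
      then show "g (f z) \<in> right_half_plane"
        using g(2) by auto
    qed
    ultimately show "(\<lambda>z. H (g (f z))) holomorphic_on ball 0 1"
      using holomorphic_on_compose_gen[of "\<lambda>z. g (f z)" "ball 0 1" H right_half_plane] H by (simp add: o_def)
    fix z :: complex
    assume "z \<in> ball 0 1"
    then have "f z \<in> comb_image"
      using fim by blast
    then obtain s where "s \<in> right_half_plane" "f z = comb_fun c s"
      by blast
    then show "norm (f z) powr p \<le> Re (H (g (f z)))"
      using le g(2) by simp
  qed
qed

text \<open>The growth of \<open>f\<close> passes to the explicit map through \<open>\<psi>\<close>,
  which bounds the real part at \<open>2 ^ n\<close> by a multiple of \<open>2 powr (n / p)\<close>.
  At \<open>2 ^ Suc m\<close> that real part is at least \<open>pi / 4 * c m\<close> minus a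
  constant.\<close>

lemma coefficient_bound_of_in_hardy:
  assumes f: "riemann_map f comb_image" and p: "p > 0" and hardy: "in_hardy p f"
  shows "\<exists>K. \<forall>m. c m \<le> K * 2 powr (real m / p)"
proof -
  let ?F = "comb_fun c \<circ> cayley"
  have fhol: "f holomorphic_on ball 0 1" and finj: "inj_on f (ball 0 1)" and fim: "f ` ball 0 1 = comb_image"
    using f by (auto simp: riemann_map_def)
  have Fhol: "?F holomorphic_on ball 0 1" and Fim: "?F ` ball 0 1 = comb_image"
    using riemann_map_comb_image by (auto simp: riemann_map_def)
  obtain x b where xb: "x 0 = 0" "comb_image = comb_domain x b"
    using is_comb_domain_comb_image unfolding is_comb_domain_def by blast
  have "f z \<noteq> Complex 0 t" if "z \<in> ball 0 1" "t \<ge> b 0" for z t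
  proof
    assume "f z = Complex 0 t"
    then have "Complex 0 t \<in> comb_domain x b"
      using that(1) fim xb by (metis imageI)
    then show False
      using that(2) xb(1) by (auto simp: mem_comb_domain dest!: spec[of _ 0])
  qed
  then obtain K where K: "\<And>z. z \<in> ball 0 1 \<Longrightarrow> norm (f z) powr p \<le> K / (1 - norm z)"
    using in_hardy_growth[OF hardy p, of "b 0"] by blast
  have "0 \<le> K"
    using order_trans[OF powr_ge_zero K[of 0]] by simp
  obtain g where g: "g holomorphic_on f ` ball 0 1" "\<And>z. z \<in> ball 0 1 \<Longrightarrow> g (f z) = z"
    using holomorphic_has_inverse[OF fhol open_ball finj] by metis
  define \<psi> where "\<psi> = (\<lambda>z. g (?F z))"
  have \<psi>hol: "\<psi> holomorphic_on ball 0 1"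
    using holomorphic_on_compose_gen[OF Fhol g(1)] fim Fim by (simp add: \<psi>_def o_def)
  have \<psi>: "\<psi> z \<in> ball 0 1" "f (\<psi> z) = ?F z" if z: "z \<in> ball 0 1" for z
  proof -
    have "?F z \<in> f ` ball 0 1"
      using z Fim fim by blast
    then obtain y where "y \<in> ball 0 1" "?F z = f y"
      by blast
    then show "\<psi> z \<in> ball 0 1" "f (\<psi> z) = ?F z"
      using g(2)[of y] by (auto simp: \<psi>_def)
  qed
  obtain k where k: "k > 0" "\<And>z. z \<in> ball 0 1 \<Longrightarrow> k * (1 - norm z) \<le> 1 - norm (\<psi> z)"
    using disc_self_map_boundary_distance[OF \<psi>hol] \<psi>(1) by blast
  have F_le: "norm (?F z) powr p \<le> K / k / (1 - norm z)" if z: "z \<in> ball 0 1" for z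
  proof -
    have "norm (?F z) powr p \<le> K / (1 - norm (\<psi> z))"
      using K[OF \<psi>(1)[OF z]] \<psi>(2)[OF z] by simp
    also have "\<dots> \<le> K / (k * (1 - norm z))"
      using \<open>0 \<le> K\<close> k z by (intro divide_left_mono mult_pos_pos) (use \<psi>(1)[OF z] in auto)
    finally show ?thesis
      by simp
  qed
  define B where "B = (K / k) powr (1 / p)"
  have real_le: "Re (comb_fun c (of_real (2 ^ n))) \<le> B * 2 powr (real n / p)" for n
  proof -
    define s :: real where "s = 2 ^ n"
    have s: "s \<ge> 1"
      by (simp add: s_def)
    have mem: "complex_of_real s \<in> right_half_plane"
      using s by (simp add: right_half_plane_def)
    \<comment> \<open>The preimage of \<open>s\<close> under \<open>cayley\<close>, at distance
      \<open>2 / (s + 1)\<close> from the unit circle.\<close>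
    define z where "z = (of_real s - 1) / (of_real s + 1 :: complex)"
    have z: "z \<in> ball 0 1" "cayley z = of_real s"
      using inverse_cayley[OF mem] by (auto simp: z_def)
    have "z = of_real ((s - 1) / (s + 1))"
      by (simp add: z_def)
    then have "norm z = (s - 1) / (s + 1)"
      using s by (simp only: norm_of_real) simp
    then have "1 - norm z = 2 / (s + 1)"
      using s by (simp only:) (simp add: field_simps)
    then have "1 / (1 - norm z) = (s + 1) / 2"
      by simp
    also have "\<dots> \<le> s"
      using s by simp
    finally have "K / k * (1 / (1 - norm z)) \<le> K / k * s"
      using \<open>0 \<le> K\<close> k(1) by (intro mult_left_mono) auto
    then have "norm (comb_fun c (of_real s)) powr p \<le> K / k * s"
      using F_le[OF z(1)] z(2) by simp
    then have "(norm (comb_fun c (of_real s)) powr p) powr (1 / p) \<le> (K / k * s) powr (1 / p)"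
      using p by (intro powr_mono2) auto
    moreover have "(K / k * s) powr (1 / p) = B * s powr (1 / p)"
      unfolding B_def by (rule powr_mult)
    ultimately have "norm (comb_fun c (of_real s)) \<le> B * s powr (1 / p)"
      using p by (simp add: powr_powr)
    also have "s powr (1 / p) = 2 powr (real n / p)"
      by (simp add: s_def powr_powr flip: powr_realpow)
    finally show ?thesis
      using complex_Re_le_cmod[of "comb_fun c (of_real s)"] by (simp add: s_def)
  qed
  \<comment> \<open>The factor \<open>2 powr (1 / p)\<close> comes from evaluating at
    \<open>2 ^ Suc m\<close>, the pole radius of term \<open>m\<close>.\<close>
  define Q where "Q = 4 / pi * (\<bar>tail_bound\<bar> + B * 2 powr (1 / p))"
  have "c m \<le> Q * 2 powr (real m / p)" for m
  proof -
    have "c m \<le> (\<Sum>k<Suc m. c k)"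
      using sum_nonneg[of "{..<m}" c] nonneg by simp
    then have "pi / 4 * c m \<le> pi / 4 * (\<Sum>k<Suc m. c k)"
      by simp
    also have "\<dots> \<le> tail_bound + Re (comb_fun c (of_real (2 ^ Suc m)))"
      using Re_comb_fun_ge[of "of_real (2 ^ Suc m)" "Suc m"] by (simp add: right_half_plane_def norm_mult norm_power)
    also have "\<dots> \<le> \<bar>tail_bound\<bar> * 1 + B * 2 powr (real (Suc m) / p)"
      using real_le[of "Suc m"] by simp
    also have "2 powr (real (Suc m) / p) = 2 powr (1 / p) * 2 powr (real m / p)"
      by (simp add: add_divide_distrib powr_add)
    also have "\<bar>tail_bound\<bar> * 1 \<le> \<bar>tail_bound\<bar> * 2 powr (real m / p)"
      using p by (intro mult_left_mono ge_one_powr_ge_zero) auto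
    finally show ?thesis
      by (simp add: Q_def field_simps)
  qed
  then show ?thesis
    by blast
qed

end

lemma hardy_number_geometric_comb:
  assumes a: "0 \<le> a" "a < 1"
  defines "C \<equiv> comb_fun (geometric a) ` right_half_plane"
  shows "is_comb_domain C" "hardy_number C = (if a = 0 then \<infinity> else ereal (1 / a))"
proof -
  interpret arctan_series "geometric a"
    by (rule arctan_series_geometric) fact
  interpret comb_map "geometric a" 1
    by unfold_locales (use a in \<open>auto intro: ge_one_powr_ge_zero\<close>)
  show "is_comb_domain C"
    unfolding C_def by (rule is_comb_domain_comb_image)
  define f where "f = (SOME f. riemann_map f C)"
  have f: "riemann_map f comb_image"
    using someI_ex[OF exI, of "\<lambda>f. riemann_map f comb_image", OF riemann_map_comb_image] by (simp add: f_def C_def)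
  let ?p = "if a = 0 then \<infinity> else ereal (1 / a)"
  have "?p \<le> hardy_number C"
  proof (rule hardy_number_geI)
    fix r
    assume "ereal r < ?p"
    \<comment> \<open>The majorant is available for exponents at least 1 only.\<close>
    define r' where "r' = max r 1"
    have r': "r' * a < 1" "r' \<ge> 1" "r' \<ge> r"
      using \<open>ereal r < ?p\<close> a by (auto simp: r'_def max_def field_simps split: if_splits)
    \<comment> \<open>A shift that leaves an odd integer \<open>r'\<close>, where the cosine
      vanishes: at most 1 so that the angle moves by less than \<open>pi\<close>, and at most half
      the slack so that \<open>a * q < 1\<close> persists.\<close>
    define \<epsilon> where "\<epsilon> = min 1 ((1 - r' * a) / 2)"
    have \<epsilon>: "0 < \<epsilon>" "\<epsilon> \<le> 1" "\<epsilon> * a \<le> (1 - r' * a) / 2"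
    proof -
      show "0 < \<epsilon>" "\<epsilon> \<le> 1"
        using r' by (auto simp: \<epsilon>_def)
      have "\<epsilon> * a \<le> \<epsilon> * 1"
        using \<open>0 < \<epsilon>\<close> a by (intro mult_left_mono) auto
      then show "\<epsilon> * a \<le> (1 - r' * a) / 2"
        by (simp add: \<epsilon>_def)
    qed
    obtain q where q: "q \<ge> r'" "a * q < 1" "cos (q * (pi / 2)) \<noteq> 0"
    proof (cases "cos (r' * (pi / 2)) = 0")
      case True
      have "\<epsilon> * (pi / 2) < pi"
        using \<epsilon> mult_right_mono[of \<epsilon> 1 "pi / 2"] pi_gt_zero by linarith
      then have "cos (r' * (pi / 2) + \<epsilon> * (pi / 2)) \<noteq> 0"
        using \<epsilon> by (intro cos_shift_nonzero True) auto
      then have "cos ((r' + \<epsilon>) * (pi / 2)) \<noteq> 0"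
        by (simp only: distrib_right not_False_eq_True)
      moreover have "a * (r' + \<epsilon>) < 1"
        using \<epsilon> r' by (simp add: algebra_simps)
      ultimately show ?thesis
        using that[of "r' + \<epsilon>"] \<epsilon> by simp
    next
      case False
      then show ?thesis
        using that[of r'] r' by (simp add: mult.commute)
    qed
    have "q \<ge> 1"
      using q r' by simp
    obtain H where H: "H holomorphic_on right_half_plane"
      "\<And>s. s \<in> right_half_plane \<Longrightarrow> norm (arctan_sum (geometric a) s) powr q \<le> Re (H s)"
      using geometric_majorant[OF a(2) \<open>q \<ge> 1\<close> q(2,3)] by blast
    have "in_hardy q f"
    proof (rule in_hardy_transfer[OF f])
      show "(\<lambda>s. of_real (2 powr q) * (H s + H (1 / s))) holomorphic_on right_half_plane"
      proof (intro holomorphic_intros H(1) holomorphic_on_compose_gen[OF _ H(1), unfolded o_def])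
        show "(\<lambda>s. 1 / s) ` right_half_plane \<subseteq> right_half_plane"
          using inverse_in_right_half_plane by blast
      qed (auto simp: right_half_plane_def)
      fix s
      assume s: "s \<in> right_half_plane"
      have "norm (comb_fun (geometric a) s) powr q
          \<le> (norm (arctan_sum (geometric a) s) + norm (arctan_sum (geometric a) (1 / s))) powr q"
        unfolding comb_fun_def using \<open>q \<ge> 1\<close> by (intro powr_mono2 norm_triangle_ineq4) auto
      also have "\<dots> \<le> 2 powr q * (norm (arctan_sum (geometric a) s) powr q
          + norm (arctan_sum (geometric a) (1 / s)) powr q)"
        using \<open>q \<ge> 1\<close> by (intro powr_add_le) auto
      also have "\<dots> \<le> 2 powr q * (Re (H s) + Re (H (1 / s)))"
        using H(2)[OF s] H(2)[OF inverse_in_right_half_plane[OF s]] by (intro mult_left_mono add_mono) auto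
      finally show "norm (comb_fun (geometric a) s) powr q \<le> Re (of_real (2 powr q) * (H s + H (1 / s)))"
        by simp
    qed (use \<open>q \<ge> 1\<close> in auto)
    then show "\<exists>q\<ge>r. q > 0 \<and> in_hardy q (SOME f. riemann_map f C)"
      using q r' by (intro exI[of _ q]) (auto simp: f_def)
  qed
  moreover have "hardy_number C \<le> ?p"
    unfolding hardy_number_def
  proof (rule Sup_least)
    fix e
    assume "e \<in> {ereal p |p. p > 0 \<and> in_hardy p (SOME f. riemann_map f C)}"
    then obtain q where q: "e = ereal q" "q > 0" "in_hardy q f"
      by (auto simp: f_def)
    obtain K where K: "\<And>m. geometric a m \<le> K * 2 powr (real m / q)"
      using coefficient_bound_of_in_hardy[OF f q(2,3)] by blast
    \<comment> \<open>Comparison of exponential rates of the coefficients and of their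
      bound.\<close>
    have "a \<le> 1 / q"
    proof (rule ccontr)
      assume "\<not> a \<le> 1 / q"
      then have "2 powr (a - 1 / q) > 1"
        by (intro gr_one_powr) auto
      then obtain m where m: "K < (2 powr (a - 1 / q)) ^ m"
        using real_arch_pow by blast
      have "geometric a m = (2 powr (a - 1 / q)) ^ m * 2 powr (real m / q)"
        by (simp add: powr_power algebra_simps flip: powr_add)
      moreover have "K * 2 powr (real m / q) < (2 powr (a - 1 / q)) ^ m * 2 powr (real m / q)"
        using m by simp
      ultimately show False
        using K[of m] by linarith
    qed
    then show "e \<le> ?p"
      using q a by (auto simp: field_simps)
  qed
  ultimately show "hardy_number C = ?p"
    by (rule antisym[rotated])
qed

section \<open>The comb with Hardy number 1\<close>

lemma Suc_squared_le: "(real k + 1)\<^sup>2 \<le> 4 * 2 ^ k"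
proof (induction k)
  case (Suc k)
  show ?case
  proof (cases "k \<ge> 2")
    case True
    then have "2 * 2 \<le> real k * real k"
      by (intro mult_mono) auto
    then have "(real (Suc k) + 1)\<^sup>2 \<le> 2 * (real k + 1)\<^sup>2"
      using True by (simp add: power2_eq_square algebra_simps)
    then show ?thesis
      using Suc by simp
  next
    case False
    then have "k = 0 \<or> k = 1"
      by auto
    then show ?thesis
      by auto
  qed
qed auto

text \<open>The coefficients \<open>2 ^ k\<close> would violate summability; dividing by
  \<open>(k + 1)\<^sup>2\<close> restores it and leaves the exponential rate unchanged, so no
  exponent above 1 survives. The general lower bound supplies the rest.\<close>

lemma exists_comb_hardy_number_1: "\<exists>C. is_comb_domain C \<and> hardy_number C = 1"
proof -
  define c :: "nat \<Rightarrow> real" where "c = (\<lambda>k. 2 ^ k / (real k + 1)\<^sup>2)"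
  interpret arctan_series c
  proof
    have "summable (\<lambda>k. inverse (real (Suc k) ^ 2))"
      using inverse_power_summable[of 2, where 'a = real] by (subst summable_Suc_iff) auto
    then show "summable (\<lambda>k. c k / 2 ^ k)"
      by (simp add: c_def inverse_eq_divide add.commute)
  qed (simp add: c_def)
  interpret comb_map c "1 / 4"
  proof
    show "1 / 4 \<le> c k" for k
      using Suc_squared_le[of k] by (simp add: c_def field_simps)
  qed auto
  define f where "f = (SOME f. riemann_map f comb_image)"
  have f: "riemann_map f comb_image"
    using someI_ex[OF exI, of "\<lambda>f. riemann_map f comb_image", OF riemann_map_comb_image] by (simp add: f_def)
  have "hardy_number comb_image \<le> 1"
    unfolding hardy_number_def
  proof (rule Sup_least)
    fix e
    assume "e \<in> {ereal p |p. p > 0 \<and> in_hardy p (SOME f. riemann_map f comb_image)}"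
    then obtain q where q: "e = ereal q" "q > 0" "in_hardy q f"
      by (auto simp: f_def)
    obtain K where K: "\<And>m. c m \<le> K * 2 powr (real m / q)"
      using coefficient_bound_of_in_hardy[OF f q(2,3)] by blast
    have "q \<le> 1"
    proof (rule ccontr)
      assume "\<not> q \<le> 1"
      define \<rho> where "\<rho> = 2 powr (1 - 1 / q)"
      have "\<rho> > 1"
        unfolding \<rho>_def using \<open>\<not> q \<le> 1\<close> by (intro gr_one_powr) auto
      then have "filterlim (\<lambda>m. \<rho> ^ m / (real m + 1)\<^sup>2) at_top sequentially"
        by real_asymp
      then have "eventually (\<lambda>m. \<rho> ^ m / (real m + 1)\<^sup>2 > K) sequentially"
        by (simp add: filterlim_at_top_dense)
      then obtain m where m: "K < \<rho> ^ m / (real m + 1)\<^sup>2"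
        by (auto simp: eventually_sequentially)
      have "\<rho> ^ m * 2 powr (real m / q) = 2 powr real m"
        by (simp add: \<rho>_def powr_power algebra_simps diff_divide_distrib flip: powr_add)
      then have "c m = \<rho> ^ m / (real m + 1)\<^sup>2 * 2 powr (real m / q)"
        by (simp add: c_def powr_realpow)
      moreover have "K * 2 powr (real m / q) < \<rho> ^ m / (real m + 1)\<^sup>2 * 2 powr (real m / q)"
        by (rule mult_strict_right_mono[OF m]) simp
      ultimately show False
        using K[of m] by linarith
    qed
    then show "e \<le> 1"
      using q by simp
  qed
  then have "hardy_number comb_image = 1"
    using hardy_number_comb_domain_ge_1[OF is_comb_domain_comb_image] by (rule antisym)
  then show ?thesis
    using is_comb_domain_comb_image by blast
qed

theorem theorem1p1:
  shows "(\<forall>C. is_comb_domain C \<longrightarrow> hardy_number C \<ge> 1) \<and>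
         (\<forall>p::ereal. 1 \<le> p \<longrightarrow> (\<exists>C. is_comb_domain C \<and> hardy_number C = p))"
proof (intro conjI allI impI)
  show "hardy_number C \<ge> 1" if "is_comb_domain C" for C
    using that by (rule hardy_number_comb_domain_ge_1)
  fix p :: ereal
  assume p: "1 \<le> p"
  show "\<exists>C. is_comb_domain C \<and> hardy_number C = p"
  proof (cases p)
    case (real r)
    show ?thesis
    \<comment> \<open>The geometric family requires \<open>a < 1\<close>, so it reaches only values
      \<open>1 / a\<close> above 1 and the endpoint needs its own comb.\<close>
    proof (cases "r = 1")
      case True
      then show ?thesis
        using exists_comb_hardy_number_1 real by (simp add: one_ereal_def)
    next
      case False
      then have "0 < 1 / r" "1 / r < 1"
        using p real by auto
      then show ?thesis
        using hardy_number_geometric_comb[of "1 / r"] real by auto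
    qed
  next
    case PInf
    then show ?thesis
      using hardy_number_geometric_comb[of 0] by auto
  qed (use p in auto)
qed

end
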